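(* Let $K:\mathbb{S}^2\times\mathbb{S}^2\to\mathbb{C}$ be a continuous, Hermitian, positive definite kernel of the form $$K(\xi,\zeta)=\sum_{j=0}^{\infty}\sum_{k=-j}^{j}\sum_{k'=-j}^{j}d_j(k,k')\,Y_j^k(\xi)\overline{Y_j^{k'}(\zeta)},\qquad\forall\,\xi,\zeta\in\mathbb{S}^2,$$ with coefficients $d_j(k,k')\in\mathbb{C}$. For each $j$ let $D_j:\mathbb{C}^{2j+1}\to\mathbb{C}^{2j+1}$ be the linear operator $$D_j(x)=\left(\sum_{k=1}^{2j+1}d_j(k-j-1,k'-j-1)\,x_k\right)_{k'=1}^{2j+1},$$ and let $\mathcal{F}$ be the set of all $j\in\mathbb{N}=\{0,1,2,\dots\}$ for which $D_j$ is a strictly positive operator on $\mathbb{C}^{2j+1}$. If $\mathcal{F}$ includes infinitely many even and infinitely many odd values of $j\in\mathbb{N}$, then $K$ is strictly positive definite on $\mathbb{S}^2$.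
   Context: $\mathbb{S}^2$ is the unit sphere in $\mathbb{R}^3$. With colatitude $\theta$ and longitude $\varphi$, the spherical harmonics are $Y_j^k(\theta,\varphi)=\frac{1}{\sqrt{2\pi}}\sqrt{\frac{2j+1}{2}\frac{(j-k)!}{(j+k)!}}\,P_{j,k}(\cos\theta)e^{ik\varphi}$, $j\ge0$, $-j\le k\le j$, where $P_{j,k}$ are the associated Legendre polynomials; they form an orthonormal basis of $L^2(\mathbb{S}^2)$ (complex-valued functions, surface measure). Writing the general expansion $K(\xi,\zeta)=\sum_{j,j'}\sum_{k,k'}\alpha_{j,j',k,k'}Y_j^k(\xi)\overline{Y_{j'}^{k'}(\zeta)}$ with $L^2(\mathbb{S}^2\times\mathbb{S}^2)$ coefficients $\alpha_{j,j',k,k'}$, the assumed form means $\alpha_{j,j',k,k'}=d_j(k,k')\delta_{j,j'}$ and that the series converges to $K$ at every point. Hermitian: $K(\xi,\zeta)=\overline{K(\zeta,\xi)}$. A linear continuous operator $P$ on a complex Hilbert space $H$ is positive if it is self-adjoint and $\langle P(x),x\rangle\ge0$ for all $x\in H$; it is strictly positive if it is self-adjoint, bounded and $\langle P(x),x\rangle>0$ for all $x\in H\setminus\{0\}$. A Hermitian kernel $K$ is (strictly) positive definite on $\mathbb{S}^2$ if for every finite set $\Xi\subset\mathbb{S}^2$ of distinct points the matrix $(K(\xi,\zeta))_{\xi,\zeta\in\Xi}$ induces, by left multiplication, a (strictly) positive operator on $\mathbb{C}^{|\Xi|}$. *)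

theory Defs
  imports
    "HOL-Analysis.Analysis"
    "HOL-Computational_Algebra.Polynomial"
    "HOL-Library.Complex_Order"
begin

section \<open>Spherical harmonics on the unit sphere\<close>

abbreviation S2 :: "(real^3) set"
  where "S2 \<equiv> sphere 0 1"

definition spherical_point :: "real \<Rightarrow> real \<Rightarrow> real^3"
  where "spherical_point \<theta> \<phi> = vector [sin \<theta> * cos \<phi>, sin \<theta> * sin \<phi>, cos \<theta>]"

definition colatitude :: "real^3 \<Rightarrow> real"
  where "colatitude \<xi> = arccos (\<xi> $ 3)"

text \<open>At the poles the longitude is undetermined and is set to \<open>0\<close>; this does not affect the
  spherical harmonics, which vanish there unless \<open>k = 0\<close>.\<close>

definition longitude :: "real^3 \<Rightarrow> real"
  where "longitude \<xi> = Arg2pi (Complex (\<xi> $ 1) (\<xi> $ 2))"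

text \<open>Rodrigues' formula.\<close>

definition legendre_poly :: "nat \<Rightarrow> real poly"
  where "legendre_poly j = smult (1 / (2 ^ j * fact j)) ((pderiv ^^ j) ([:-1, 0, 1:] ^ j))"

text \<open>The Condon--Shortley phase \<open>(-1)^k\<close> is included, and negative orders are reduced to positive
  ones by the usual symmetry; the integer \<open>k\<close> is meant to range over \<open>-j \<le> k \<le> j\<close>.\<close>

definition assoc_legendre_nonneg :: "nat \<Rightarrow> nat \<Rightarrow> real \<Rightarrow> real"
  where "assoc_legendre_nonneg j m x =
    (-1) ^ m * sqrt (1 - x\<^sup>2) ^ m * poly ((pderiv ^^ m) (legendre_poly j)) x"

definition assoc_legendre :: "nat \<Rightarrow> int \<Rightarrow> real \<Rightarrow> real"
  where "assoc_legendre j k x =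
    (if 0 \<le> k then assoc_legendre_nonneg j (nat k) x
     else (-1) ^ nat (-k) * (fact (nat (int j + k)) / fact (nat (int j - k)))
            * assoc_legendre_nonneg j (nat (-k)) x)"

definition sph_harm :: "nat \<Rightarrow> int \<Rightarrow> real^3 \<Rightarrow> complex"
  where "sph_harm j k \<xi> =
    complex_of_real
      (1 / sqrt (2 * pi)
       * sqrt ((2 * real j + 1) / 2 * (fact (nat (int j - k)) / fact (nat (int j + k))))
       * assoc_legendre j k (cos (colatitude \<xi>)))
    * exp (\<i> * of_int k * complex_of_real (longitude \<xi>))"

text \<open>The surface measure \<open>sin \<theta> d\<theta> d\<phi>\<close>, as a measure whose underlying space is the sphere.\<close>

definition surface_measure :: "(real^3) measure"
  where "surface_measure =
    distr (density (restrict_space lborel ({0..pi} \<times> {0..2 * pi})) (\<lambda>(\<theta>, \<phi>). ennreal (sin \<theta>)))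
      (restrict_space borel S2) (\<lambda>(\<theta>, \<phi>). spherical_point \<theta> \<phi>)"

section \<open>Kernels and their expansions\<close>

text \<open>The coefficient of \<open>K\<close> with respect to the orthonormal basis
  \<open>(\<xi>, \<zeta>) \<mapsto> Y\<^sub>j\<^sup>k(\<xi>) cnj (Y\<^sub>j\<^sub>'\<^sup>k\<^sup>'(\<zeta>))\<close> of \<open>L\<^sup>2\<close> of the product of two spheres.\<close>

definition sph_coeff ::
    "(real^3 \<Rightarrow> real^3 \<Rightarrow> complex) \<Rightarrow> nat \<Rightarrow> nat \<Rightarrow> int \<Rightarrow> int \<Rightarrow> complex"
  where "sph_coeff K j j' k k' =
    (LINT p|(surface_measure \<Otimes>\<^sub>M surface_measure).
       K (fst p) (snd p) * cnj (sph_harm j k (fst p) * cnj (sph_harm j' k' (snd p))))"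

text \<open>\<open>K(\<xi>, \<zeta>) = \<Sum>\<^sub>j \<Sum>\<^sub>k \<Sum>\<^sub>k\<^sub>' d\<^sub>j(k, k') Y\<^sub>j\<^sup>k(\<xi>) cnj (Y\<^sub>j\<^sup>k\<^sup>'(\<zeta>))\<close>: the \<open>L\<^sup>2\<close> coefficients of \<open>K\<close> are
  \<open>d\<^sub>j(k, k')\<close> on the diagonal \<open>j = j'\<close> and zero elsewhere, and the series, summed over the degree
  \<open>j\<close>, converges to \<open>K\<close> at every point.\<close>

definition has_block_expansion ::
    "(real^3 \<Rightarrow> real^3 \<Rightarrow> complex) \<Rightarrow> (nat \<Rightarrow> int \<Rightarrow> int \<Rightarrow> complex) \<Rightarrow> bool"
  where "has_block_expansion K d \<longleftrightarrow>
    (\<forall>j j'. \<forall>k\<in>{-int j..int j}. \<forall>k'\<in>{-int j'..int j'}.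
       sph_coeff K j j' k k' = (if j = j' then d j k k' else 0)) \<and>
    (\<forall>\<xi>\<in>S2. \<forall>\<zeta>\<in>S2.
       (\<lambda>j. \<Sum>k=-int j..int j. \<Sum>k'=-int j..int j.
              d j k k' * sph_harm j k \<xi> * cnj (sph_harm j k' \<zeta>)) sums K \<xi> \<zeta>)"

section \<open>Positive operators on finite-dimensional coordinate spaces\<close>

text \<open>For a finite set \<open>I\<close>, the Hilbert space of complex vectors indexed by \<open>I\<close> is modelled by the
  extensional functions on \<open>I\<close>.\<close>

abbreviation coord_space :: "'i set \<Rightarrow> ('i \<Rightarrow> complex) set"
  where "coord_space I \<equiv> (\<Pi>\<^sub>E i\<in>I. UNIV)"

definition coord_inner :: "'i set \<Rightarrow> ('i \<Rightarrow> complex) \<Rightarrow> ('i \<Rightarrow> complex) \<Rightarrow> complex"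
  where "coord_inner I x y = (\<Sum>i\<in>I. x i * cnj (y i))"

definition coord_norm :: "'i set \<Rightarrow> ('i \<Rightarrow> complex) \<Rightarrow> real"
  where "coord_norm I x = sqrt (\<Sum>i\<in>I. (cmod (x i))\<^sup>2)"

definition bounded_operator_on :: "'i set \<Rightarrow> (('i \<Rightarrow> complex) \<Rightarrow> 'i \<Rightarrow> complex) \<Rightarrow> bool"
  where "bounded_operator_on I P \<longleftrightarrow>
    P \<in> coord_space I \<rightarrow> coord_space I \<and>
    (\<forall>x\<in>coord_space I. \<forall>y\<in>coord_space I. P (\<lambda>i\<in>I. x i + y i) = (\<lambda>i\<in>I. P x i + P y i)) \<and>
    (\<forall>c. \<forall>x\<in>coord_space I. P (\<lambda>i\<in>I. c * x i) = (\<lambda>i\<in>I. c * P x i)) \<and>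
    (\<exists>B. \<forall>x\<in>coord_space I. coord_norm I (P x) \<le> B * coord_norm I x)"

definition self_adjoint_on :: "'i set \<Rightarrow> (('i \<Rightarrow> complex) \<Rightarrow> 'i \<Rightarrow> complex) \<Rightarrow> bool"
  where "self_adjoint_on I P \<longleftrightarrow>
    (\<forall>x\<in>coord_space I. \<forall>y\<in>coord_space I. coord_inner I (P x) y = coord_inner I x (P y))"

text \<open>The order on complex numbers is the one for which \<open>0 \<le> z\<close> (\<open>0 < z\<close>) says that \<open>z\<close> is real and
  nonnegative (positive).\<close>

definition positive_operator_on :: "'i set \<Rightarrow> (('i \<Rightarrow> complex) \<Rightarrow> 'i \<Rightarrow> complex) \<Rightarrow> bool"
  where "positive_operator_on I P \<longleftrightarrow>
    bounded_operator_on I P \<and> self_adjoint_on I P \<and>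
    (\<forall>x\<in>coord_space I. 0 \<le> coord_inner I (P x) x)"

definition strictly_positive_operator_on :: "'i set \<Rightarrow> (('i \<Rightarrow> complex) \<Rightarrow> 'i \<Rightarrow> complex) \<Rightarrow> bool"
  where "strictly_positive_operator_on I P \<longleftrightarrow>
    bounded_operator_on I P \<and> self_adjoint_on I P \<and>
    (\<forall>x\<in>coord_space I - {\<lambda>i\<in>I. 0}. 0 < coord_inner I (P x) x)"

section \<open>Positive definite kernels\<close>

definition hermitian_kernel :: "(real^3 \<Rightarrow> real^3 \<Rightarrow> complex) \<Rightarrow> bool"
  where "hermitian_kernel K \<longleftrightarrow> (\<forall>\<xi>\<in>S2. \<forall>\<zeta>\<in>S2. K \<xi> \<zeta> = cnj (K \<zeta> \<xi>))"

definition kernel_operator ::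
    "(real^3 \<Rightarrow> real^3 \<Rightarrow> complex) \<Rightarrow> (real^3) set \<Rightarrow> (real^3 \<Rightarrow> complex) \<Rightarrow> real^3 \<Rightarrow> complex"
  where "kernel_operator K \<Xi> x = (\<lambda>\<xi>\<in>\<Xi>. \<Sum>\<zeta>\<in>\<Xi>. K \<xi> \<zeta> * x \<zeta>)"

definition positive_definite_kernel :: "(real^3 \<Rightarrow> real^3 \<Rightarrow> complex) \<Rightarrow> bool"
  where "positive_definite_kernel K \<longleftrightarrow> hermitian_kernel K \<and>
    (\<forall>\<Xi>. finite \<Xi> \<and> \<Xi> \<subseteq> S2 \<longrightarrow> positive_operator_on \<Xi> (kernel_operator K \<Xi>))"

definition strictly_positive_definite_kernel :: "(real^3 \<Rightarrow> real^3 \<Rightarrow> complex) \<Rightarrow> bool"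
  where "strictly_positive_definite_kernel K \<longleftrightarrow> hermitian_kernel K \<and>
    (\<forall>\<Xi>. finite \<Xi> \<and> \<Xi> \<subseteq> S2 \<longrightarrow> strictly_positive_operator_on \<Xi> (kernel_operator K \<Xi>))"

text \<open>The operator \<open>D\<^sub>j\<close>, on vectors indexed by \<open>1, \<dots>, 2j + 1\<close>. The sum runs over the first
  argument of \<open>d\<^sub>j\<close>, that is, the transpose of the matrix \<open>d\<^sub>j\<close> is applied.\<close>

definition block_operator ::
    "(nat \<Rightarrow> int \<Rightarrow> int \<Rightarrow> complex) \<Rightarrow> nat \<Rightarrow> (nat \<Rightarrow> complex) \<Rightarrow> nat \<Rightarrow> complex"
  where "block_operator d j x =
    (\<lambda>k'\<in>{1..2 * j + 1}. \<Sum>k=1..2 * j + 1. d j (int k - int j - 1) (int k' - int j - 1) * x k)"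

definition strictly_positive_degrees :: "(nat \<Rightarrow> int \<Rightarrow> int \<Rightarrow> complex) \<Rightarrow> nat set"
  where "strictly_positive_degrees d =
    {j. strictly_positive_operator_on {1..2 * j + 1} (block_operator d j)}"

end

theory Submission
  imports Defs "HOL-Real_Asymp.Real_Asymp"
begin

text \<open>
  For finite \<open>\<Xi>\<close> and a vector \<open>x\<close>, inserting the expansion of \<open>K\<close> writes the quadratic form of the
  kernel matrix as a sum over the degrees \<open>j\<close> of the quadratic forms of the operators \<open>D\<^sub>j\<close>, evaluated
  at the vector \<open>a\<^sub>j(k) = \<Sum>\<^sub>\<xi> cnj (x \<xi>) Y\<^sub>j\<^sup>k(\<xi>)\<close> (\<open>kernel_quadratic_form_sums\<close>). Every \<open>D\<^sub>j\<close> is positive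
  semidefinite, since its form is a double integral of \<open>K\<close> against a harmonic of degree \<open>j\<close>, and such
  integrals are limits of quadratic forms of kernel matrices (\<open>kernel_form_nonneg\<close>,
  \<open>block_form_nonneg\<close>). So if the form of the kernel matrix vanishes at \<open>x\<close>, then \<open>a\<^sub>j = 0\<close> for every
  strictly positive degree \<open>j\<close>.

  It remains to see that a finite combination \<open>\<Sum>\<^sub>\<xi> c\<^sub>\<xi> \<delta>\<^sub>\<xi>\<close> of point evaluations that annihilates the
  harmonics of infinitely many even and infinitely many odd degrees is zero
  (\<open>harmonic_annihilator_trivial\<close>). Instead of the addition theorem, the argument uses harmonics whose
  order is close to their degree. With \<open>u = \<xi>\<^sub>1 + i \<xi>\<^sub>2\<close> and \<open>t = \<xi>\<^sub>3\<close>, the harmonic of degree \<open>j\<close> and order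
  \<open>j - l\<close> is a multiple of \<open>u\<^bsup>j - l\<^esup> q\<^sub>j\<^sub>l(t)\<close>, where \<open>q\<^sub>j\<^sub>l\<close> is a derivative of \<open>(t\<^sup>2 - 1)\<^sup>j\<close> of degree \<open>l\<close> and
  \<open>q\<^sub>j\<^sub>l(t) / (2j)! \<longlongrightarrow> t\<^sup>l / l!\<close> as \<open>j\<close> grows. The points with the largest modulus \<open>s\<close> of \<open>u\<close> dominate, and
  dividing by \<open>s\<^bsup>j - l\<^esup>\<close> leaves \<open>\<Sum> c\<^sub>\<xi> (u/s)\<^sup>j (t s / u)\<^sup>l \<longlongrightarrow> 0\<close> for every \<open>l\<close>. Polynomials in \<open>t s / u\<close> separate
  the points up to antipodes, and antipodal points are separated by the two parities of \<open>j\<close>. On the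
  equator, where \<open>t = 0\<close>, the even \<open>l = 2m\<close> alone are used, normalized by \<open>q\<^sub>j\<^sub>l(0)\<close>, and \<open>u\<^bsup>-2\<^esup>\<close> takes the
  place of \<open>t s / u\<close>. At the poles, where \<open>u = 0\<close>, the zonal harmonics suffice.
\<close>

section \<open>Derivatives of powers of \<open>x\<^sup>2 - 1\<close>\<close>

lemma higher_pderiv_monom_real:
  fixes c :: real
  shows "m \<le> n \<Longrightarrow> (pderiv ^^ m) (monom c n) = monom (c * (fact n / fact (n - m))) (n - m)"
proof (induction m)
  case 0
  then show ?case by simp
next
  case (Suc m)
  then have "n - m = Suc (n - Suc m)"
    by simp
  then have "fact (n - m) = real (n - m) * fact (n - Suc m)"
    by (metis fact_Suc)
  with Suc show ?case
    by (simp add: pderiv_monom)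
qed

lemma higher_pderiv_monom_eq_0:
  fixes c :: real
  assumes "n < m"
  shows "(pderiv ^^ m) (monom c n) = 0"
proof -
  have "(pderiv ^^ m) (monom c n) = (pderiv ^^ (m - Suc n)) ((pderiv ^^ Suc n) (monom c n))"
    using assms funpow_add[of "m - Suc n" "Suc n" "pderiv :: real poly \<Rightarrow> _"] by (simp del: funpow.simps)
  also have "(pderiv ^^ Suc n) (monom c n) = 0"
    using higher_pderiv_monom_real[of n n c] by (simp add: pderiv_monom)
  finally show ?thesis
    by simp
qed

text \<open>The \<open>(2j - l)\<close>-th derivative of \<open>(x\<^sup>2 - 1)\<^sup>j\<close> has degree \<open>l\<close>. Counting from the top in this
  way keeps the degree fixed while \<open>j\<close> grows; up to constants it is the polynomial factor of the
  associated Legendre function of degree \<open>j\<close> and order \<open>j - l\<close>.\<close>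

definition rodrigues_deriv :: "nat \<Rightarrow> nat \<Rightarrow> real poly"
  where "rodrigues_deriv j l = (pderiv ^^ (2 * j - l)) ([:-1, 0, 1:] ^ j)"

lemma square_minus_one_power:
  "[:-1, 0, 1 :: real:] ^ j = (\<Sum>i\<le>j. monom ((-1) ^ i * real (j choose i)) (2 * j - 2 * i))"
proof -
  have "[:-1, 0, 1 :: real:] = [:-1:] + monom 1 2"
    by (simp add: monom_altdef power2_eq_square)
  then have "[:-1, 0, 1 :: real:] ^ j
      = (\<Sum>i\<le>j. of_nat (j choose i) * [:-1:] ^ i * monom 1 2 ^ (j - i))"
    by (simp only: binomial_ring)
  also have "\<dots> = (\<Sum>i\<le>j. monom ((-1) ^ i * real (j choose i)) (2 * j - 2 * i))"
    by (intro sum.cong refl)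
      (simp add: monom_power poly_const_pow of_nat_poly smult_monom diff_mult_distrib mult.commute)
  finally show ?thesis .
qed

lemma poly_rodrigues_deriv:
  assumes "l \<le> 2 * j"
  shows "poly (rodrigues_deriv j l) t =
    (\<Sum>i\<le>l div 2. (-1) ^ i * real (j choose i) * (fact (2 * j - 2 * i) / fact (l - 2 * i))
       * t ^ (l - 2 * i))"
proof -
  let ?p = "\<lambda>i. (pderiv ^^ (2 * j - l)) (monom ((-1) ^ i * real (j choose i)) (2 * j - 2 * i))"
  have "rodrigues_deriv j l = (\<Sum>i\<le>j. ?p i)"
    by (simp add: rodrigues_deriv_def square_minus_one_power higher_pderiv_sum)
  also have "\<dots> = (\<Sum>i\<le>l div 2. ?p i)"
    using assms by (intro sum.mono_neutral_right ballI higher_pderiv_monom_eq_0) auto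
  finally have "poly (rodrigues_deriv j l) t = (\<Sum>i\<le>l div 2. poly (?p i) t)"
    by (simp only: poly_sum)
  also have "\<dots> = (\<Sum>i\<le>l div 2. (-1) ^ i * real (j choose i)
      * (fact (2 * j - 2 * i) / fact (l - 2 * i)) * t ^ (l - 2 * i))"
  proof (intro sum.cong refl)
    fix i assume "i \<in> {..l div 2}"
    then have "2 * i \<le> l"
      by simp
    with assms have "2 * j - l \<le> 2 * j - 2 * i" "2 * j - 2 * i - (2 * j - l) = l - 2 * i"
      by linarith+
    then show "poly (?p i) t = (-1) ^ i * real (j choose i)
        * (fact (2 * j - 2 * i) / fact (l - 2 * i)) * t ^ (l - 2 * i)"
      by (simp only: higher_pderiv_monom_real poly_monom)
  qed
  finally show ?thesis .
qed

lemma poly_rodrigues_deriv_minus: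
  assumes "l \<le> 2 * j"
  shows "poly (rodrigues_deriv j l) (- t) = (-1) ^ l * poly (rodrigues_deriv j l) t"
proof -
  have "(- t) ^ (l - 2 * i) = (-1) ^ l * t ^ (l - 2 * i)" if "i \<le> l div 2" for i
  proof -
    have "even (2 * i)" "2 * i \<le> l"
      using that by auto
    then have "even (l - 2 * i) \<longleftrightarrow> even l"
      by simp
    then show ?thesis
      by (simp add: power_minus[of t] minus_one_power_iff)
  qed
  then show ?thesis
    unfolding poly_rodrigues_deriv[OF assms]
    by (auto simp: sum_distrib_left mult_ac intro!: sum.cong)
qed

lemma poly_rodrigues_deriv_0:
  assumes "2 * m \<le> 2 * j"
  shows "poly (rodrigues_deriv j (2 * m)) 0 = (-1) ^ m * real (j choose m) * fact (2 * j - 2 * m)"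
proof -
  have "poly (rodrigues_deriv j (2 * m)) 0 =
    (\<Sum>i\<le>m. if i = m then (-1) ^ m * real (j choose m) * fact (2 * j - 2 * m) else 0)"
    unfolding poly_rodrigues_deriv[OF assms] by (intro sum.cong) auto
  then show ?thesis
    by simp
qed

text \<open>The factor \<open>(x - 1)\<^sup>j\<close> gives \<open>(x\<^sup>2 - 1)\<^sup>j\<close> a zero of order exactly \<open>j\<close> at \<open>1\<close>, and every derivative
  lowers that order by one. This is the value of the Legendre polynomial at a pole.\<close>

lemma poly_rodrigues_deriv_1: "poly (rodrigues_deriv j j) 1 \<noteq> 0"
proof -
  let ?p = "[:-1, 0, 1 :: real:] ^ j"
  have factors: "?p = [:-1, 1:] ^ j * [:1, 1:] ^ j"
    by (simp flip: power_mult_distrib)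
  have nz: "?p \<noteq> 0"
    by simp
  have "(pderiv ^^ i) ?p \<noteq> 0 \<and> Polynomial.order 1 ((pderiv ^^ i) ?p) = j - i" if "i \<le> j" for i
    using that
  proof (induction i)
    case 0
    have "Polynomial.order 1 ?p = j"
    proof -
      have "Polynomial.order 1 ([:1, 1 :: real:] ^ j) = 0"
        by (rule order_0I) simp
      moreover have "Polynomial.order 1 ([:-1, 1 :: real:] ^ j) = j"
        by (rule order_power_n_n)
      ultimately show ?thesis
        using order_mult[of "[:-1, 1:] ^ j" "[:1, 1 :: real:] ^ j" 1] nz unfolding factors by linarith
    qed
    with nz show ?case by simp
  next
    case (Suc i)
    let ?q = "(pderiv ^^ i) ?p"
    have q: "?q \<noteq> 0" "Polynomial.order 1 ?q = Suc (j - Suc i)"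
      using Suc by auto
    have root: "poly ?q 1 = 0"
      using q by (simp add: order_root)
    have "pderiv ?q \<noteq> 0"
    proof
      assume "pderiv ?q = 0"
      then obtain c where "?q = [:c:]"
        by (metis degree_eq_zeroE pderiv_eq_0_iff)
      then show False
        using q root by simp
    qed
    with q root show ?case
      using order_pderiv[of ?q 1] by simp
  qed
  from this[of j] have "Polynomial.order 1 (rodrigues_deriv j j) = 0" "rodrigues_deriv j j \<noteq> 0"
    by (auto simp: rodrigues_deriv_def mult_2)
  then show ?thesis
    by (metis order_root)
qed

text \<open>Up to sign and the factor \<open>1 / (l - 2i)!\<close>, this is the coefficient of \<open>t\<^bsup>l - 2i\<^esup>\<close> in the polynomial
  \<open>rodrigues_deriv j l\<close> after division by \<open>(2j)!\<close>.\<close>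

definition coeff_ratio :: "nat \<Rightarrow> nat \<Rightarrow> real"
  where "coeff_ratio i j = real (j choose i) * fact (2 * j - 2 * i) / fact (2 * j)"

lemma coeff_ratio_Suc:
  assumes "i < j"
  shows "coeff_ratio (Suc i) j
    = coeff_ratio i j * (1 / (2 * (real i + 1) * (2 * (real j - real i) - 1)))"
proof -
  obtain n where n: "j = Suc (i + n)"
    using assms less_imp_Suc_add by blast
  have 1: "real (Suc i) * real (j choose Suc i) = real (Suc n) * real (j choose i)"
  proof -
    have "Suc i * (j choose Suc i) = (j - i) * (j choose i)"
      by (simp only: binomial_absorb_comp binomial_absorption)
    also have "j - i = Suc n"
      using n by simp
    finally show ?thesis
      by (simp only: flip: of_nat_mult)
  qed
  have 2: "fact (2 * j - 2 * i) = 2 * (real n + 1) * (2 * real n + 1) * fact (2 * j - 2 * Suc i)"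
    using n by (simp add: algebra_simps)
  have 3: "real j - real i = real n + 1"
    using n by simp
  have "(real i + 1) * coeff_ratio (Suc i) j * (2 * (2 * real n + 1)) = coeff_ratio i j"
  proof -
    have "(real i + 1) * coeff_ratio (Suc i) j * (2 * (2 * real n + 1))
        = (real (Suc i) * real (j choose Suc i))
          * (2 * (2 * real n + 1) * fact (2 * j - 2 * Suc i) / fact (2 * j))"
      unfolding coeff_ratio_def by simp
    also have "\<dots> = coeff_ratio i j"
      unfolding coeff_ratio_def 1 2 by (simp add: algebra_simps)
    finally show ?thesis .
  qed
  then have "coeff_ratio (Suc i) j * (2 * (real i + 1) * (2 * real n + 1)) = coeff_ratio i j"
    by (simp add: algebra_simps)
  moreover have "2 * (real i + 1) * (2 * real n + 1) \<noteq> 0"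
    by (simp add: add_nonneg_eq_0_iff)
  ultimately have "coeff_ratio (Suc i) j = coeff_ratio i j / (2 * (real i + 1) * (2 * real n + 1))"
    by (metis nonzero_eq_divide_eq)
  moreover have "2 * (real j - real i) - 1 = 2 * real n + 1"
    using n by simp
  ultimately show ?thesis
    by simp
qed

text \<open>Consecutive ratios differ by a factor of order \<open>1/j\<close>, so only the leading coefficient survives.\<close>

lemma coeff_ratio_tendsto: "coeff_ratio i \<longlonglongrightarrow> (if i = 0 then 1 else 0)"
proof (induction i)
  case 0
  then show ?case by (simp add: coeff_ratio_def)
next
  case (Suc i)
  have "(\<lambda>j. 1 / (2 * (real i + 1) * (2 * (real j - real i) - 1))) \<longlonglongrightarrow> 0"
    by real_asymp
  from tendsto_mult[OF Suc this]
  have "(\<lambda>j. coeff_ratio i j * (1 / (2 * (real i + 1) * (2 * (real j - real i) - 1)))) \<longlonglongrightarrow> 0"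
    by simp
  moreover have "\<forall>\<^sub>F j in sequentially.
      coeff_ratio i j * (1 / (2 * (real i + 1) * (2 * (real j - real i) - 1))) = coeff_ratio (Suc i) j"
    using eventually_gt_at_top[of i] by eventually_elim (simp add: coeff_ratio_Suc)
  ultimately show ?case
    by (simp add: Lim_transform_eventually)
qed

text \<open>The decay of the ratios is only polynomial in \<open>j\<close>. On the equator every other coefficient is
  multiplied by a vanishing power of \<open>t\<close>, so the values there have this size, which still beats
  the exponentially small contribution of the points off the equator.\<close>

lemma coeff_ratio_lower_bound:
  assumes "m \<le> j" "0 < j"
  shows "coeff_ratio m j * (2 * real j) ^ (2 * m) \<ge> 1"
proof -
  have "fact (2 * j) div fact (2 * j - 2 * m) \<le> (2 * j) ^ (2 * m)"
    using assms by (intro fact_div_fact_le_pow) auto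
  then have "fact (2 * j) \<le> (2 * j) ^ (2 * m) * fact (2 * j - 2 * m)"
    by (metis diff_le_self dvd_mult_div_cancel fact_dvd mult.commute mult_le_mono1)
  then have "real (fact (2 * j)) \<le> real ((2 * j) ^ (2 * m) * fact (2 * j - 2 * m))"
    by (simp only: of_nat_le_iff)
  then have le: "fact (2 * j) \<le> (2 * real j) ^ (2 * m) * fact (2 * j - 2 * m)"
    by simp
  have "real (j choose m) \<ge> 1"
    using assms by (metis One_nat_def Suc_leI of_nat_1 of_nat_le_iff zero_less_binomial)
  then have "1 * fact (2 * j) \<le> real (j choose m) * ((2 * real j) ^ (2 * m) * fact (2 * j - 2 * m))"
    using le by (intro mult_mono) auto
  then show ?thesis
    by (simp add: coeff_ratio_def field_simps)
qed

text \<open>The limits \<open>t\<^sup>l\<close> for \<open>l = 0, 1, 2, \<dots>\<close> are what makes it possible to tell points of different height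
  \<open>t\<close> apart.\<close>

lemma rodrigues_deriv_tendsto:
  "(\<lambda>j. poly (rodrigues_deriv j l) t / fact (2 * j)) \<longlonglongrightarrow> t ^ l / fact l"
proof -
  have "(\<lambda>j. \<Sum>i\<le>l div 2. (-1) ^ i * coeff_ratio i j * (t ^ (l - 2 * i) / fact (l - 2 * i)))
      \<longlonglongrightarrow> (\<Sum>i\<le>l div 2. (-1) ^ i * (if i = 0 then 1 else 0) * (t ^ (l - 2 * i) / fact (l - 2 * i)))"
    by (intro tendsto_intros coeff_ratio_tendsto)
  also have "(\<Sum>i\<le>l div 2. (-1) ^ i * (if i = 0 then 1 else 0) * (t ^ (l - 2 * i) / fact (l - 2 * i)))
      = (\<Sum>i\<le>l div 2. if i = 0 then t ^ l / fact l else 0)"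
    by (intro sum.cong) auto
  also have "\<dots> = t ^ l / fact l"
    by simp
  finally have lim: "(\<lambda>j. \<Sum>i\<le>l div 2. (-1) ^ i * coeff_ratio i j
      * (t ^ (l - 2 * i) / fact (l - 2 * i))) \<longlonglongrightarrow> t ^ l / fact l" .
  have "\<forall>\<^sub>F j in sequentially. (\<Sum>i\<le>l div 2. (-1) ^ i * coeff_ratio i j
      * (t ^ (l - 2 * i) / fact (l - 2 * i))) = poly (rodrigues_deriv j l) t / fact (2 * j)"
    using eventually_ge_at_top[of l]
  proof eventually_elim
    case (elim j)
    then have "l \<le> 2 * j" by simp
    then show ?case
      by (simp add: poly_rodrigues_deriv coeff_ratio_def sum_divide_distrib mult_ac)
  qed
  with lim show ?thesis
    by (rule Lim_transform_eventually)
qed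

section \<open>Spherical harmonics in Cartesian coordinates\<close>

text \<open>The projection to the equatorial plane, read as a complex number; on the sphere it is
  \<open>sin \<theta> e\<^bsup>i\<phi>\<^esup>\<close>.\<close>

definition equatorial :: "real^3 \<Rightarrow> complex"
  where "equatorial \<xi> = Complex (\<xi> $ 1) (\<xi> $ 2)"

text \<open>Up to a constant factor, the spherical harmonic of degree \<open>j\<close> and order \<open>j - l\<close>, as a polynomial in
  the Cartesian coordinates.\<close>

definition unnormalized_harm :: "nat \<Rightarrow> nat \<Rightarrow> real^3 \<Rightarrow> complex"
  where "unnormalized_harm j l \<xi> =
    equatorial \<xi> ^ (j - l) * of_real (poly (rodrigues_deriv j l) (\<xi> $ 3))"

lemma equatorial_minus: "equatorial (- \<xi>) = - equatorial \<xi>"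
  by (simp add: equatorial_def complex_eq_iff)

lemma sphere_coordinates:
  assumes "\<xi> \<in> S2"
  shows "(cmod (equatorial \<xi>))\<^sup>2 + (\<xi> $ 3)\<^sup>2 = 1"
proof -
  have "inner \<xi> \<xi> = 1"
    using assms by (simp add: norm_eq_1)
  then show ?thesis
    unfolding equatorial_def cmod_power2 by (simp add: inner_vec_def sum_3 power2_eq_square)
qed

lemma vec3_eq_equatorialI:
  assumes "equatorial \<xi> = equatorial \<zeta>" "\<xi> $ 3 = \<zeta> $ 3"
  shows "\<xi> = \<zeta>"
  using assms by (simp add: vec_eq_iff forall_3 equatorial_def)

lemma unnormalized_harm_minus:
  assumes "l \<le> j"
  shows "unnormalized_harm j l (- \<xi>) = (-1) ^ j * unnormalized_harm j l \<xi>"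
proof -
  have "(-1 :: complex) ^ j = (-1) ^ (j - l) * (-1) ^ l"
    using assms by (simp flip: power_add)
  then show ?thesis
    using assms
    by (simp add: unnormalized_harm_def equatorial_minus poly_rodrigues_deriv_minus
        power_minus[of "equatorial \<xi>"])
qed

lemma norm_equatorial:
  assumes "\<xi> \<in> S2"
  shows "sqrt (1 - (\<xi> $ 3)\<^sup>2) = cmod (equatorial \<xi>)"
  using sphere_coordinates[OF assms] by (intro real_sqrt_unique) auto

lemma cos_colatitude:
  assumes "\<xi> \<in> S2"
  shows "cos (colatitude \<xi>) = \<xi> $ 3"
proof -
  have "(\<xi> $ 3)\<^sup>2 \<le> 1"
    using sphere_coordinates[OF assms] zero_le_power2[of "cmod (equatorial \<xi>)"] by linarith
  then have "\<bar>\<xi> $ 3\<bar> \<le> 1"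
    by (simp add: abs_square_le_1)
  then show ?thesis
    by (simp add: colatitude_def cos_arccos_abs)
qed

lemma polar_equatorial:
  "complex_of_real (cmod (equatorial \<xi>)) * exp (\<i> * of_real (longitude \<xi>)) = equatorial \<xi>"
  using Arg2pi_eq[of "equatorial \<xi>"] by (simp add: longitude_def equatorial_def)

lemma assoc_legendre_nonneg_eq:
  assumes "\<xi> \<in> S2" "m \<le> j"
  shows "assoc_legendre_nonneg j m (\<xi> $ 3) = (-1) ^ m / (2 ^ j * fact j)
    * cmod (equatorial \<xi>) ^ m * poly (rodrigues_deriv j (j - m)) (\<xi> $ 3)"
proof -
  have "2 * j - (j - m) = m + j"
    using assms by simp
  then have "(pderiv ^^ m) ((pderiv ^^ j) ([:-1, 0, 1:] ^ j)) = rodrigues_deriv j (j - m)"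
    by (simp only: rodrigues_deriv_def funpow_add comp_apply)
  then show ?thesis
    using assms
    by (simp add: assoc_legendre_nonneg_def norm_equatorial legendre_poly_def higher_pderiv_smult)
qed

text \<open>The factor \<open>(sin \<theta>)\<^sup>m\<close> of the associated Legendre function and the exponential combine to the \<open>m\<close>-th
  power of the equatorial coordinate. At the poles the longitude is arbitrary but both sides vanish
  unless \<open>m = 0\<close>.\<close>

lemma sph_harm_nonneg_order:
  assumes "m \<le> j"
  shows "\<exists>c. c \<noteq> 0 \<and> (\<forall>\<xi>\<in>S2. sph_harm j (int m) \<xi> = c * unnormalized_harm j (j - m) \<xi>)"
proof -
  let ?N = "1 / sqrt (2 * pi) * sqrt ((2 * real j + 1) / 2 * (fact (nat (int j - int m)) / fact (nat (int j + int m))))"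
  let ?c = "complex_of_real (?N * ((-1) ^ m / (2 ^ j * fact j)))"
  have "sph_harm j (int m) \<xi> = ?c * unnormalized_harm j (j - m) \<xi>" if "\<xi> \<in> S2" for \<xi>
  proof -
    have "of_real (cmod (equatorial \<xi>)) ^ m * exp (\<i> * of_int (int m) * of_real (longitude \<xi>))
        = equatorial \<xi> ^ m"
      by (subst polar_equatorial[symmetric])
        (simp only: power_mult_distrib, simp flip: exp_of_nat_mult add: mult_ac)
    then show ?thesis
      using assms that
      by (simp add: sph_harm_def cos_colatitude assoc_legendre_def assoc_legendre_nonneg_eq
          unnormalized_harm_def)
  qed
  moreover have "?c \<noteq> 0"
    by simp
  ultimately show ?thesis
    by blast
qed

lemma sph_harm_neg_order:
  assumes "m \<le> j" "0 < m"
  shows "\<exists>c. \<forall>\<xi>\<in>S2. sph_harm j (- int m) \<xi> = c * cnj (unnormalized_harm j (j - m) \<xi>)"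
proof -
  let ?N = "1 / sqrt (2 * pi) * sqrt ((2 * real j + 1) / 2 * (fact (nat (int j - (- int m))) / fact (nat (int j + (- int m)))))"
  let ?M = "(-1) ^ m * (fact (nat (int j - int m)) / fact (nat (int j + int m)))"
  let ?c = "complex_of_real (?N * (?M * ((-1) ^ m / (2 ^ j * fact j))))"
  have "sph_harm j (- int m) \<xi> = ?c * cnj (unnormalized_harm j (j - m) \<xi>)" if "\<xi> \<in> S2" for \<xi>
  proof -
    have "of_real (cmod (equatorial \<xi>)) ^ m * exp (\<i> * of_int (- int m) * of_real (longitude \<xi>))
        = cnj (equatorial \<xi>) ^ m"
      by (subst polar_equatorial[symmetric])
        (simp only: complex_cnj_mult exp_cnj power_mult_distrib,
          simp flip: exp_of_nat_mult add: mult_ac)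
    then show ?thesis
      using assms that
      by (simp add: sph_harm_def cos_colatitude assoc_legendre_def assoc_legendre_nonneg_eq
          unnormalized_harm_def)
  qed
  then show ?thesis
    by blast
qed

lemma continuous_on_unnormalized_harm: "continuous_on S (unnormalized_harm j l)"
  unfolding unnormalized_harm_def equatorial_def Complex_eq by (intro continuous_intros)

lemma continuous_on_sph_harm:
  assumes "k \<in> {- int j..int j}"
  shows "continuous_on S2 (sph_harm j k)"
proof (cases "0 \<le> k")
  case True
  then obtain m where "k = int m" "m \<le> j"
    using assms by (metis atLeastAtMost_iff nonneg_int_cases of_nat_le_iff)
  then obtain c where "\<forall>\<xi>\<in>S2. sph_harm j k \<xi> = c * unnormalized_harm j (j - m) \<xi>"
    using sph_harm_nonneg_order by blast
  then show ?thesis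
    by (subst continuous_on_cong[OF refl])
      (auto intro!: continuous_intros continuous_on_unnormalized_harm)
next
  case False
  define m where "m = nat (- k)"
  have "k = - int m" "m \<le> j" "0 < m"
    using False assms by (auto simp: m_def)
  then obtain c where "\<forall>\<xi>\<in>S2. sph_harm j k \<xi> = c * cnj (unnormalized_harm j (j - m) \<xi>)"
    using sph_harm_neg_order by blast
  then show ?thesis
    by (subst continuous_on_cong[OF refl])
      (auto intro!: continuous_intros continuous_on_unnormalized_harm)
qed

section \<open>Separating points by the growth of harmonics of high order\<close>

text \<open>A polynomial in \<open>w\<close> that vanishes at all values of \<open>w\<close> on \<open>E\<close> except \<open>w0\<close> is a finite combination of
  the moments and isolates the terms over \<open>w0\<close>.\<close>

lemma moment_separation:
  fixes f :: "'a \<Rightarrow> 'b \<Rightarrow> complex" and w :: "'a \<Rightarrow> complex"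
  assumes "finite E"
    and moments: "\<And>m. ((\<lambda>j. \<Sum>x\<in>E. f x j * w x ^ m) \<longlongrightarrow> 0) F"
  shows "((\<lambda>j. \<Sum>x | x \<in> E \<and> w x = w0. f x j) \<longlongrightarrow> 0) F"
proof -
  define p where "p = (\<Prod>v\<in>w ` E - {w0}. [:-v, 1:])"
  have p0: "poly p w0 \<noteq> 0"
    using \<open>finite E\<close> by (auto simp: p_def poly_prod)
  have p: "poly p (w x) = 0" if "x \<in> E" "w x \<noteq> w0" for x
  proof -
    have "w x \<in> w ` E - {w0}" using that by auto
    then show ?thesis
      unfolding p_def poly_prod using \<open>finite E\<close> by (intro prod_zero) (auto intro: bexI[of _ "w x"])
  qed
  have "((\<lambda>j. \<Sum>m\<le>degree p. coeff p m * (\<Sum>x\<in>E. f x j * w x ^ m)) \<longlongrightarrow> (\<Sum>m\<le>degree p. coeff p m * 0)) F"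
    by (intro tendsto_intros moments)
  moreover have "(\<Sum>m\<le>degree p. coeff p m * (\<Sum>x\<in>E. f x j * w x ^ m))
      = poly p w0 * (\<Sum>x | x \<in> E \<and> w x = w0. f x j)" for j
  proof -
    have "(\<Sum>m\<le>degree p. coeff p m * (\<Sum>x\<in>E. f x j * w x ^ m)) = (\<Sum>x\<in>E. f x j * poly p (w x))"
      unfolding poly_altdef sum_distrib_left by (subst sum.swap) (simp add: mult_ac)
    also have "\<dots> = (\<Sum>x | x \<in> E \<and> w x = w0. f x j * poly p (w x))"
      using \<open>finite E\<close> p by (intro sum.mono_neutral_right) auto
    finally show ?thesis
      by (simp add: sum_distrib_left mult.commute)
  qed
  ultimately have "((\<lambda>j. poly p w0 * (\<Sum>x | x \<in> E \<and> w x = w0. f x j)) \<longlongrightarrow> 0) F"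
    by simp
  from tendsto_mult_left[OF this, of "inverse (poly p w0)"] p0 show ?thesis
    by (simp flip: mult.assoc)
qed

text \<open>If a vanishing sum has negligible terms outside \<open>E\<close>, then the leading parts \<open>f\<close> of the terms in
  \<open>E\<close> must cancel in the limit.\<close>

lemma dominant_part_tendsto_0:
  fixes T f :: "'a \<Rightarrow> 'b \<Rightarrow> complex"
  assumes "finite X" "E \<subseteq> X"
    and "\<forall>\<^sub>F j in F. (\<Sum>x\<in>X. T x j) = 0"
    and "\<And>x. x \<in> X - E \<Longrightarrow> (T x \<longlongrightarrow> 0) F"
    and "\<And>x. x \<in> E \<Longrightarrow> ((\<lambda>j. T x j - f x j) \<longlongrightarrow> 0) F"
  shows "((\<lambda>j. \<Sum>x\<in>E. f x j) \<longlongrightarrow> 0) F"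
proof -
  have "((\<lambda>j. - (\<Sum>x\<in>X - E. T x j) - (\<Sum>x\<in>E. T x j - f x j)) \<longlongrightarrow> - (\<Sum>x\<in>X - E. 0) - (\<Sum>x\<in>E. 0)) F"
    using assms(4,5) by (intro tendsto_intros)
  then have "((\<lambda>j. - (\<Sum>x\<in>X - E. T x j) - (\<Sum>x\<in>E. T x j - f x j)) \<longlongrightarrow> 0) F"
    by simp
  moreover have "\<forall>\<^sub>F j in F. - (\<Sum>x\<in>X - E. T x j) - (\<Sum>x\<in>E. T x j - f x j) = (\<Sum>x\<in>E. f x j)"
    using assms(3)
  proof eventually_elim
    case (elim j)
    then have "(\<Sum>x\<in>X - E. T x j) + (\<Sum>x\<in>E. T x j) = 0"
      using sum.subset_diff[OF \<open>E \<subseteq> X\<close> \<open>finite X\<close>, of "\<lambda>x. T x j"] by simp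
    then show ?case
      by (simp add: sum_subtractf algebra_simps)
  qed
  ultimately show ?thesis
    by (rule Lim_transform_eventually)
qed

lemma power_diff_tendsto_0:
  fixes x :: complex
  assumes "cmod x < 1"
  shows "(\<lambda>j. x ^ (j - l)) \<longlonglongrightarrow> 0"
  using LIMSEQ_power_zero[OF assms] filterlim_minus_const_nat_at_top
  by (rule filterlim_compose)

text \<open>Among points with equatorial coordinate \<open>u\<close> of the largest modulus \<open>s\<close>, the power \<open>(u/s)\<^bsup>j - l\<^esup>\<close> has
  modulus one; extracting \<open>(u/s)\<^sup>j\<close>, which does not depend on \<open>l\<close>, leaves the \<open>l\<close>-th power of
  \<open>t s / u\<close>, where \<open>t\<close> is the height of the point.\<close>

lemma nonequatorial_leading_term:
  fixes s :: real
  assumes "cmod (equatorial \<xi>) = s" "0 < s"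
  shows "(\<lambda>j. unnormalized_harm j l \<xi> * (fact l / (s ^ (j - l) * fact (2 * j)))
      - (equatorial \<xi> / s) ^ j * (of_real (\<xi> $ 3) * complex_of_real s / equatorial \<xi>) ^ l) \<longlonglongrightarrow> 0"
    (is "?D \<longlonglongrightarrow> 0")
proof -
  let ?q = "\<lambda>j. poly (rodrigues_deriv j l) (\<xi> $ 3) / fact (2 * j)"
  let ?u = "equatorial \<xi>"
  have "(\<lambda>j. \<bar>fact l * ?q j - (\<xi> $ 3) ^ l\<bar>) \<longlonglongrightarrow> \<bar>fact l * ((\<xi> $ 3) ^ l / fact l) - (\<xi> $ 3) ^ l\<bar>"
    by (intro tendsto_intros rodrigues_deriv_tendsto)
  then have "(\<lambda>j. \<bar>fact l * ?q j - (\<xi> $ 3) ^ l\<bar>) \<longlonglongrightarrow> 0"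
    by simp
  moreover have "\<forall>\<^sub>F j in sequentially. norm (?D j) \<le> \<bar>fact l * ?q j - (\<xi> $ 3) ^ l\<bar>"
    using eventually_ge_at_top[of l]
  proof eventually_elim
    case (elim j)
    have u: "?u \<noteq> 0" using assms by auto
    have s: "complex_of_real s \<noteq> 0" using assms by simp
    have "(?u / s) ^ j = (?u / s) ^ (j - l) * (?u / s) ^ l"
      using elim by (simp flip: power_add)
    moreover have "(?u / s) ^ l * (of_real (\<xi> $ 3) * complex_of_real s / ?u) ^ l = of_real (\<xi> $ 3) ^ l"
      using u s by (simp flip: power_mult_distrib)
    ultimately have "?D j = (?u / s) ^ (j - l) * of_real (fact l * ?q j - (\<xi> $ 3) ^ l)"
      using s u by (simp add: unnormalized_harm_def algebra_simps power_divide)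
    moreover have "norm (?u / s) = 1"
      using assms by (simp add: norm_divide)
    ultimately show ?case
      by (simp only: norm_mult norm_power norm_of_real power_one mult_1 order_refl)
  qed
  ultimately show ?thesis
    by (rule Lim_null_comparison[rotated])
qed

lemma nonequatorial_lower_term:
  fixes s :: real
  assumes "cmod (equatorial \<xi>) < s"
  shows "(\<lambda>j. unnormalized_harm j l \<xi> * (fact l / (s ^ (j - l) * fact (2 * j)))) \<longlonglongrightarrow> 0"
proof -
  have "cmod (equatorial \<xi> / s) < 1"
    using assms le_less_trans[OF norm_ge_zero assms] by (simp add: norm_divide)
  then have "(\<lambda>j. (equatorial \<xi> / s) ^ (j - l)
      * of_real (fact l * (poly (rodrigues_deriv j l) (\<xi> $ 3) / fact (2 * j))))
      \<longlonglongrightarrow> 0 * of_real (fact l * ((\<xi> $ 3) ^ l / fact l))"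
    by (intro tendsto_intros rodrigues_deriv_tendsto power_diff_tendsto_0)
  then show ?thesis
    by (simp add: unnormalized_harm_def power_divide mult_ac)
qed

text \<open>On the equator \<open>t = 0\<close> and only even \<open>l\<close> contribute. There the polynomial factor reduces to its
  constant term, which serves as the normalization, and the identity is exact.\<close>

lemma equatorial_leading_term:
  assumes "\<xi> \<in> S2" "cmod (equatorial \<xi>) = 1" "2 * m \<le> j"
  shows "unnormalized_harm j (2 * m) \<xi> / ((-1) ^ m * of_real (coeff_ratio m j * fact (2 * j)))
    = equatorial \<xi> ^ j * (1 / (equatorial \<xi>)\<^sup>2) ^ m"
proof -
  have "\<xi> $ 3 = 0"
    using sphere_coordinates[OF assms(1)] assms(2) by simp
  moreover have "equatorial \<xi> \<noteq> 0"
    using assms(2) by auto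
  moreover have "real (j choose m) \<noteq> 0"
    using assms(3) by simp
  ultimately show ?thesis
    using assms(3)
    by (simp add: unnormalized_harm_def poly_rodrigues_deriv_0 coeff_ratio_def power_diff
        power_divide flip: power_mult)
qed

lemma equatorial_lower_term:
  assumes "cmod (equatorial \<xi>) < 1"
  shows "(\<lambda>j. unnormalized_harm j (2 * m) \<xi>
    / ((-1) ^ m * of_real (coeff_ratio m j * fact (2 * j)))) \<longlonglongrightarrow> 0" (is "?T \<longlonglongrightarrow> 0")
proof -
  let ?x = "cmod (equatorial \<xi>)"
  let ?q = "\<lambda>j. poly (rodrigues_deriv j (2 * m)) (\<xi> $ 3) / fact (2 * j)"
  have "(\<lambda>j. (2 * real j) ^ (2 * m) * ?x ^ (j - 2 * m)) \<longlonglongrightarrow> 0"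
  proof (cases "?x = 0")
    case True
    have "\<forall>\<^sub>F j in sequentially. 0 = (2 * real j) ^ (2 * m) * ?x ^ (j - 2 * m)"
      using eventually_gt_at_top[of "2 * m"] by eventually_elim (simp only: True, simp)
    then show ?thesis
      by (rule Lim_transform_eventually[OF tendsto_const])
  next
    case False
    then have "0 < ?x"
      by simp
    define x where "x = ?x"
    have x: "0 < x" "x < 1"
      using \<open>0 < ?x\<close> assms by (simp_all only: x_def)
    then have "(\<lambda>j. (2 * real j) ^ (2 * m) * x ^ j) \<longlonglongrightarrow> 0"
      by real_asymp
    from tendsto_mult_right[OF this, of "1 / x ^ (2 * m)"]
    have lim: "(\<lambda>j. (2 * real j) ^ (2 * m) * x ^ j * (1 / x ^ (2 * m))) \<longlonglongrightarrow> 0"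
      by simp
    have "\<forall>\<^sub>F j in sequentially. (2 * real j) ^ (2 * m) * x ^ j * (1 / x ^ (2 * m))
        = (2 * real j) ^ (2 * m) * x ^ (j - 2 * m)"
      using eventually_ge_at_top[of "2 * m"] by eventually_elim (use x in \<open>simp add: power_diff\<close>)
    with lim show ?thesis
      unfolding x_def by (rule Lim_transform_eventually)
  qed
  then have "(\<lambda>j. (2 * real j) ^ (2 * m) * ?x ^ (j - 2 * m) * \<bar>?q j\<bar>)
      \<longlonglongrightarrow> 0 * \<bar>(\<xi> $ 3) ^ (2 * m) / fact (2 * m)\<bar>"
    by (intro tendsto_intros rodrigues_deriv_tendsto)
  then have "(\<lambda>j. (2 * real j) ^ (2 * m) * ?x ^ (j - 2 * m) * \<bar>?q j\<bar>) \<longlonglongrightarrow> 0"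
    by simp
  moreover have "\<forall>\<^sub>F j in sequentially.
      norm (?T j) \<le> (2 * real j) ^ (2 * m) * ?x ^ (j - 2 * m) * \<bar>?q j\<bar>"
    using eventually_gt_at_top[of m]
  proof eventually_elim
    case (elim j)
    have ge: "coeff_ratio m j * (2 * real j) ^ (2 * m) \<ge> 1"
      using elim by (intro coeff_ratio_lower_bound) auto
    moreover have pos: "coeff_ratio m j > 0"
      using elim by (simp add: coeff_ratio_def)
    ultimately have "1 / coeff_ratio m j \<le> (2 * real j) ^ (2 * m)"
      by (simp add: field_simps)
    moreover have "norm (?T j) = 1 / coeff_ratio m j * (?x ^ (j - 2 * m) * \<bar>?q j\<bar>)"
      using pos by (simp add: unnormalized_harm_def norm_mult norm_divide norm_power)
    ultimately show ?case
      by (simp only: mult.assoc) (rule mult_right_mono, auto)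
  qed
  ultimately show ?thesis
    by (rule Lim_null_comparison[rotated])
qed

lemma vec3_antipodalI:
  assumes "equatorial \<xi> = - equatorial \<zeta>" "\<xi> $ 3 = - \<zeta> $ 3"
  shows "\<xi> = - \<zeta>"
  using assms by (intro vec3_eq_equatorialI) (simp_all add: equatorial_minus)

text \<open>The ratio of height to equatorial coordinate cannot distinguish antipodal points, but at fixed
  latitude up to sign it distinguishes everything else.\<close>

lemma nonequatorial_separation:
  assumes "\<xi> \<in> S2" "\<zeta> \<in> S2" "cmod (equatorial \<xi>) = s" "cmod (equatorial \<zeta>) = s" "0 < s" "s < 1"
    and "of_real (\<xi> $ 3) * complex_of_real s / equatorial \<xi> = of_real (\<zeta> $ 3) * of_real s / equatorial \<zeta>"
  shows "\<xi> = \<zeta> \<or> \<xi> = - \<zeta>"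
proof -
  have sq: "(\<xi> $ 3)\<^sup>2 = 1 - s\<^sup>2" "(\<zeta> $ 3)\<^sup>2 = 1 - s\<^sup>2"
    using sphere_coordinates[OF assms(1)] sphere_coordinates[OF assms(2)] assms(3,4) by simp_all
  have "s\<^sup>2 < 1"
    using assms(5,6) by (simp add: power_less_one_iff abs_square_less_1)
  with sq have nz: "\<xi> $ 3 \<noteq> 0" "\<zeta> $ 3 \<noteq> 0"
    by auto
  have u: "equatorial \<xi> \<noteq> 0" "equatorial \<zeta> \<noteq> 0"
    using assms(3-5) by auto
  have eq: "of_real (\<xi> $ 3) * equatorial \<zeta> = of_real (\<zeta> $ 3) * equatorial \<xi>"
    using assms(5,7) u by (simp add: field_simps)
  have "\<xi> $ 3 = \<zeta> $ 3 \<or> \<xi> $ 3 = - \<zeta> $ 3"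
    using sq by (simp flip: power2_eq_iff)
  then show ?thesis
  proof
    assume *: "\<xi> $ 3 = \<zeta> $ 3"
    with eq nz have "equatorial \<xi> = equatorial \<zeta>"
      by simp
    with * show ?thesis
      by (simp add: vec3_eq_equatorialI)
  next
    assume *: "\<xi> $ 3 = - \<zeta> $ 3"
    then have "of_real (\<zeta> $ 3) * equatorial \<xi> = of_real (\<zeta> $ 3) * - equatorial \<zeta>"
      using eq by simp
    with nz have "equatorial \<xi> = - equatorial \<zeta>"
      by (simp only: mult_cancel_left of_real_eq_0_iff simp_thms)
    with * show ?thesis
      by (simp add: vec3_antipodalI)
  qed
qed

lemma equator_separation:
  assumes "\<xi> \<in> S2" "\<zeta> \<in> S2" "cmod (equatorial \<xi>) = 1" "cmod (equatorial \<zeta>) = 1"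
    and "1 / (equatorial \<xi>)\<^sup>2 = 1 / (equatorial \<zeta>)\<^sup>2"
  shows "\<xi> = \<zeta> \<or> \<xi> = - \<zeta>"
proof -
  have "\<xi> $ 3 = 0" "\<zeta> $ 3 = 0"
    using sphere_coordinates[OF assms(1)] sphere_coordinates[OF assms(2)] assms(3,4) by simp_all
  moreover have "equatorial \<xi> = equatorial \<zeta> \<or> equatorial \<xi> = - equatorial \<zeta>"
    using assms(5) by (simp flip: power2_eq_iff)
  ultimately show ?thesis
    using vec3_eq_equatorialI vec3_antipodalI by auto
qed

text \<open>The points of \<open>X\<close> with nonzero coefficient that are closest to the equator dominate the harmonics
  of order \<open>j - l\<close> as \<open>j\<close> grows with \<open>l\<close> fixed. Letting \<open>l\<close> vary separates these points up to
  antipodes. The behaviour of \<open>b\<close> and of the harmonics under the antipodal map makes the contributions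
  of an antipodal pair add up instead of cancelling, and their sum has constant modulus
  \<open>2 \<bar>b \<xi>\<bar>\<close>, so it can only tend to zero if \<open>b \<xi> = 0\<close>. If only the two poles remain, the zonal harmonic
  (order zero) is nonzero there and finishes the argument.\<close>

lemma equivariant_coefficients_vanish:
  fixes b :: "real^3 \<Rightarrow> complex"
  assumes X: "finite X" "X \<subseteq> S2" "\<And>\<xi>. \<xi> \<in> X \<Longrightarrow> - \<xi> \<in> X"
    and b: "\<And>\<xi>. \<xi> \<in> X \<Longrightarrow> b (- \<xi>) = \<sigma> * b \<xi>"
    and J: "infinite J" "\<And>j. j \<in> J \<Longrightarrow> (-1) ^ j = \<sigma>"
    and zero: "\<And>j l. j \<in> J \<Longrightarrow> l \<le> j \<Longrightarrow> (\<Sum>\<xi>\<in>X. b \<xi> * unnormalized_harm j l \<xi>) = 0"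
  shows "\<forall>\<xi>\<in>X. b \<xi> = 0"
proof (rule ccontr)
  assume not_all_zero: "\<not> (\<forall>\<xi>\<in>X. b \<xi> = 0)"
  define Y where "Y = {\<xi> \<in> X. b \<xi> \<noteq> 0}"
  define s where "s = Max ((\<lambda>\<xi>. cmod (equatorial \<xi>)) ` Y)"
  have Y: "finite Y" "Y \<noteq> {}" "Y \<subseteq> S2" "Y \<subseteq> X"
    using X not_all_zero by (auto simp: Y_def)
  obtain j0 where "j0 \<in> J"
    using J(1) by (metis ex_in_conv finite.emptyI)
  then have "\<sigma> = 1 \<or> \<sigma> = -1"
    using J(2)[of j0] by (metis minus_one_power_iff)
  then have \<sigma>: "\<sigma> * \<sigma> = 1" "\<sigma> \<noteq> 0"
    by auto
  have Y_minus: "- \<xi> \<in> Y" if "\<xi> \<in> Y" for \<xi>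
    using that X(3) b \<sigma> by (auto simp: Y_def)
  have zeroY: "(\<Sum>\<xi>\<in>Y. b \<xi> * unnormalized_harm j l \<xi>) = 0" if "j \<in> J" "l \<le> j" for j l
  proof -
    have "(\<Sum>\<xi>\<in>Y. b \<xi> * unnormalized_harm j l \<xi>) = (\<Sum>\<xi>\<in>X. b \<xi> * unnormalized_harm j l \<xi>)"
      using X(1) by (intro sum.mono_neutral_left) (auto simp: Y_def)
    then show ?thesis
      using zero[OF that] by simp
  qed
  have "s \<in> (\<lambda>\<xi>. cmod (equatorial \<xi>)) ` Y"
    unfolding s_def using Y by (intro Max_in) auto
  then obtain \<xi>0 where \<xi>0: "\<xi>0 \<in> Y" "cmod (equatorial \<xi>0) = s"
    by auto
  have le_s: "cmod (equatorial \<xi>) \<le> s" if "\<xi> \<in> Y" for \<xi>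
    unfolding s_def using Y that by (intro Max_ge) auto
  have \<xi>0': "\<xi>0 \<in> S2" "- \<xi>0 \<in> Y" "b \<xi>0 \<noteq> 0" "b (- \<xi>0) = \<sigma> * b \<xi>0"
    using \<xi>0(1) Y Y_minus b by (auto simp: Y_def)
  have "\<xi>0 \<noteq> - \<xi>0"
  proof
    assume "\<xi>0 = - \<xi>0"
    then have "\<xi>0 = 0"
      by (metis add_eq_0_iff scaleR_2 scaleR_eq_0_iff zero_neq_numeral)
    then show False
      using \<xi>0'(1) by simp
  qed
  show False
  proof (cases "s = 0")
    case True
    \<comment> \<open>all points of \<open>Y\<close> are poles, and the zonal harmonic is nonzero there\<close>
    have "Y \<subseteq> {\<xi>0, - \<xi>0}"
    proof
      fix \<xi> assume "\<xi> \<in> Y"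
      then have "\<xi> \<in> S2" "equatorial \<xi> = 0"
        using Y le_s True by auto
      moreover have "equatorial \<xi>0 = 0"
        using \<xi>0 True by simp
      ultimately have "(\<xi> $ 3)\<^sup>2 = (\<xi>0 $ 3)\<^sup>2"
        using sphere_coordinates[of \<xi>] sphere_coordinates[OF \<xi>0'(1)] by simp
      then have "\<xi> $ 3 = \<xi>0 $ 3 \<or> \<xi> $ 3 = - \<xi>0 $ 3"
        by (simp flip: power2_eq_iff)
      then show "\<xi> \<in> {\<xi>0, - \<xi>0}"
        using \<open>equatorial \<xi> = 0\<close> \<open>equatorial \<xi>0 = 0\<close> vec3_eq_equatorialI vec3_antipodalI by auto
    qed
    then have "Y = {\<xi>0, - \<xi>0}"
      using \<xi>0(1) \<xi>0'(2) by auto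
    then have "b \<xi>0 * unnormalized_harm j0 j0 \<xi>0 + b (- \<xi>0) * unnormalized_harm j0 j0 (- \<xi>0) = 0"
      using zeroY[OF \<open>j0 \<in> J\<close> order_refl] \<open>\<xi>0 \<noteq> - \<xi>0\<close> by simp
    then have "b \<xi>0 * unnormalized_harm j0 j0 \<xi>0 + (\<sigma> * \<sigma>) * (b \<xi>0 * unnormalized_harm j0 j0 \<xi>0) = 0"
      using J(2)[OF \<open>j0 \<in> J\<close>] by (simp add: unnormalized_harm_minus \<xi>0'(4) mult_ac)
    then have "unnormalized_harm j0 j0 \<xi>0 = 0"
      using \<sigma> \<xi>0'(3) by (simp flip: mult_2)
    then have "poly (rodrigues_deriv j0 j0) (\<xi>0 $ 3) = 0"
      by (simp add: unnormalized_harm_def)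
    moreover have "\<xi>0 $ 3 = 1 \<or> \<xi>0 $ 3 = -1"
      using sphere_coordinates[OF \<xi>0'(1)] \<xi>0(2) True by (simp add: power2_eq_1_iff)
    ultimately show False
      using poly_rodrigues_deriv_1[of j0] poly_rodrigues_deriv_minus[of j0 j0 1] by auto
  next
    case False
    then have "0 < s"
      using \<xi>0(2) by (metis norm_ge_zero less_le)
    define E where "E = {\<xi> \<in> Y. cmod (equatorial \<xi>) = s}"
    \<comment> \<open>the filter of \<open>j \<longlongrightarrow> \<infinity>\<close> inside \<open>J\<close>\<close>
    define F where "F = inf sequentially (principal J)"
    have "F \<noteq> bot"
      using J(1) unfolding F_def trivial_limit_def eventually_inf_principal
      by (auto simp: eventually_sequentially infinite_nat_iff_unbounded_le)
    have onF: "(f \<longlongrightarrow> y) F" if "f \<longlonglongrightarrow> y" for f and y :: complex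
      using that unfolding F_def by (rule tendsto_mono[OF inf_le1])
    have zeroF: "\<forall>\<^sub>F j in F. (\<Sum>\<xi>\<in>Y. b \<xi> * unnormalized_harm j l \<xi>) = 0" for l
      unfolding F_def eventually_inf_principal
      using eventually_ge_at_top[of l] by eventually_elim (auto simp: zeroY)
    have E: "finite E" "E \<subseteq> Y" "E \<subseteq> S2" "\<xi>0 \<in> E" "- \<xi>0 \<in> E"
      using Y \<xi>0 \<xi>0' by (auto simp: E_def equatorial_minus)
    have less_s: "cmod (equatorial \<xi>) < s" if "\<xi> \<in> Y - E" for \<xi>
      using that le_s[of \<xi>] by (auto simp: E_def)
    \<comment> \<open>\<open>w\<close> is the quantity whose powers appear in the leading terms: \<open>t s / u\<close> off the equator,
      where \<open>t \<noteq> 0\<close>, and \<open>u\<^bsup>-2\<^esup>\<close> on the equator\<close>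
    have "\<exists>w. (\<forall>m. ((\<lambda>j. \<Sum>\<xi>\<in>E. b \<xi> * (equatorial \<xi> / s) ^ j * w \<xi> ^ m) \<longlongrightarrow> 0) F)
      \<and> w (- \<xi>0) = w \<xi>0 \<and> (\<forall>\<xi>\<in>E. w \<xi> = w \<xi>0 \<longrightarrow> \<xi> = \<xi>0 \<or> \<xi> = - \<xi>0)"
    proof (cases "s < 1")
      case True
      let ?w = "\<lambda>\<xi>. of_real (\<xi> $ 3) * complex_of_real s / equatorial \<xi>"
      have "((\<lambda>j. \<Sum>\<xi>\<in>E. b \<xi> * (equatorial \<xi> / s) ^ j * ?w \<xi> ^ l) \<longlongrightarrow> 0) F" for l
      proof (rule dominant_part_tendsto_0)
        let ?T = "\<lambda>\<xi> j. b \<xi> * (unnormalized_harm j l \<xi> * (fact l / (s ^ (j - l) * fact (2 * j))))"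
        show "\<forall>\<^sub>F j in F. (\<Sum>\<xi>\<in>Y. ?T \<xi> j) = 0"
          using zeroF[of l]
          by eventually_elim (simp only: mult.assoc[symmetric] sum_distrib_right[symmetric] mult_zero_left)
        show "(?T \<xi> \<longlongrightarrow> 0) F" if "\<xi> \<in> Y - E" for \<xi>
          using tendsto_mult_right_zero[OF nonequatorial_lower_term[OF less_s[OF that]]] by (rule onF)
        show "((\<lambda>j. ?T \<xi> j - b \<xi> * (equatorial \<xi> / s) ^ j * ?w \<xi> ^ l) \<longlongrightarrow> 0) F" if "\<xi> \<in> E" for \<xi>
        proof -
          have "cmod (equatorial \<xi>) = s"
            using that by (simp add: E_def)
          from onF[OF tendsto_mult_right_zero[OF nonequatorial_leading_term[OF this \<open>0 < s\<close>], of "b \<xi>" l]]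
          show ?thesis
            by (simp only: right_diff_distrib mult.assoc)
        qed
      qed (use Y E in auto)
      moreover have "?w (- \<xi>0) = ?w \<xi>0"
        by (simp add: equatorial_minus)
      moreover have "\<forall>\<xi>\<in>E. ?w \<xi> = ?w \<xi>0 \<longrightarrow> \<xi> = \<xi>0 \<or> \<xi> = - \<xi>0"
        using E True \<open>0 < s\<close> \<xi>0(2) by (intro ballI impI nonequatorial_separation) (auto simp: E_def)
      ultimately show ?thesis
        by (intro exI[of _ ?w]) blast
    next
      case False
      have "s\<^sup>2 \<le> 1"
        using sphere_coordinates[OF \<xi>0'(1), unfolded \<xi>0(2)] zero_le_power2[of "\<xi>0 $ 3"]
        by linarith
      then have "s = 1"
        using False \<open>0 < s\<close> by (simp add: power_le_one_iff abs_square_le_1)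
      let ?w = "\<lambda>\<xi>. 1 / (equatorial \<xi>)\<^sup>2"
      have "((\<lambda>j. \<Sum>\<xi>\<in>E. b \<xi> * (equatorial \<xi> / s) ^ j * ?w \<xi> ^ m) \<longlongrightarrow> 0) F" for m
      proof (rule dominant_part_tendsto_0)
        let ?T = "\<lambda>\<xi> j. b \<xi> * (unnormalized_harm j (2 * m) \<xi>
          / ((-1) ^ m * of_real (coeff_ratio m j * fact (2 * j))))"
        show "\<forall>\<^sub>F j in F. (\<Sum>\<xi>\<in>Y. ?T \<xi> j) = 0"
          using zeroF[of "2 * m"]
          by eventually_elim (simp only: times_divide_eq_right sum_divide_distrib[symmetric] div_0)
        show "(?T \<xi> \<longlongrightarrow> 0) F" if "\<xi> \<in> Y - E" for \<xi>
          using tendsto_mult_right_zero[OF equatorial_lower_term] less_s[OF that] \<open>s = 1\<close>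
          by (auto intro!: onF)
        show "((\<lambda>j. ?T \<xi> j - b \<xi> * (equatorial \<xi> / s) ^ j * ?w \<xi> ^ m) \<longlongrightarrow> 0) F" if "\<xi> \<in> E" for \<xi>
        proof (rule onF, rule Lim_transform_eventually[OF tendsto_const])
          have "\<xi> \<in> S2" "cmod (equatorial \<xi>) = 1"
            using that E \<open>s = 1\<close> by (auto simp: E_def)
          show "\<forall>\<^sub>F j in sequentially. 0 = ?T \<xi> j - b \<xi> * (equatorial \<xi> / s) ^ j * ?w \<xi> ^ m"
            using eventually_ge_at_top[of "2 * m"]
          proof eventually_elim
            case (elim j)
            from equatorial_leading_term[OF \<open>\<xi> \<in> S2\<close> \<open>cmod (equatorial \<xi>) = 1\<close> this] show ?case
              by (simp only: \<open>s = 1\<close> of_real_1 div_by_1 mult.assoc diff_self)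
          qed
        qed
      qed (use Y E in auto)
      moreover have "?w (- \<xi>0) = ?w \<xi>0"
        by (simp add: equatorial_minus)
      moreover have "\<forall>\<xi>\<in>E. ?w \<xi> = ?w \<xi>0 \<longrightarrow> \<xi> = \<xi>0 \<or> \<xi> = - \<xi>0"
        using E \<open>s = 1\<close> \<xi>0(2) by (intro ballI impI equator_separation) (auto simp: E_def)
      ultimately show ?thesis
        by (intro exI[of _ ?w]) blast
    qed
    then obtain w where moments: "\<And>m. ((\<lambda>j. \<Sum>\<xi>\<in>E. b \<xi> * (equatorial \<xi> / s) ^ j * w \<xi> ^ m) \<longlongrightarrow> 0) F"
      and w: "w (- \<xi>0) = w \<xi>0" "\<And>\<xi>. \<xi> \<in> E \<Longrightarrow> w \<xi> = w \<xi>0 \<Longrightarrow> \<xi> = \<xi>0 \<or> \<xi> = - \<xi>0"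
      by blast
    have "{\<xi>. \<xi> \<in> E \<and> w \<xi> = w \<xi>0} = {\<xi>0, - \<xi>0}"
      using E w by auto
    with moment_separation[OF \<open>finite E\<close> moments, of "w \<xi>0"] \<open>\<xi>0 \<noteq> - \<xi>0\<close>
    have "((\<lambda>j. b \<xi>0 * (equatorial \<xi>0 / s) ^ j + b (- \<xi>0) * (equatorial (- \<xi>0) / s) ^ j) \<longlongrightarrow> 0) F"
      by simp
    then have lim: "((\<lambda>j. cmod (b \<xi>0 * (equatorial \<xi>0 / s) ^ j + b (- \<xi>0) * (equatorial (- \<xi>0) / s) ^ j)) \<longlongrightarrow> 0) F"
      by (rule tendsto_norm_zero)
    have "\<forall>\<^sub>F j in F. cmod (b \<xi>0 * (equatorial \<xi>0 / s) ^ j + b (- \<xi>0) * (equatorial (- \<xi>0) / s) ^ j)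
        = 2 * cmod (b \<xi>0)"
      unfolding F_def eventually_inf_principal
    proof (intro always_eventually allI impI)
      fix j assume "j \<in> J"
      have "(equatorial (- \<xi>0) / s) ^ j = \<sigma> * (equatorial \<xi>0 / s) ^ j"
        using J(2)[OF \<open>j \<in> J\<close>] by (simp add: equatorial_minus power_minus[of "equatorial \<xi>0 / s"])
      then have "b \<xi>0 * (equatorial \<xi>0 / s) ^ j + b (- \<xi>0) * (equatorial (- \<xi>0) / s) ^ j
          = b \<xi>0 * (equatorial \<xi>0 / s) ^ j + (\<sigma> * \<sigma>) * (b \<xi>0 * (equatorial \<xi>0 / s) ^ j)"
        by (simp add: \<xi>0'(4) mult_ac)
      also have "\<dots> = 2 * (b \<xi>0 * (equatorial \<xi>0 / s) ^ j)"
        by (simp add: \<sigma>)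
      finally show "cmod (b \<xi>0 * (equatorial \<xi>0 / s) ^ j + b (- \<xi>0) * (equatorial (- \<xi>0) / s) ^ j)
          = 2 * cmod (b \<xi>0)"
        using \<xi>0(2) \<open>0 < s\<close> by (simp add: norm_mult norm_power norm_divide)
    qed
    with lim have "((\<lambda>_. 2 * cmod (b \<xi>0)) \<longlongrightarrow> 0) F"
      by (rule Lim_transform_eventually)
    then have "2 * cmod (b \<xi>0) = 0"
      using \<open>F \<noteq> bot\<close> by (simp add: tendsto_const_iff)
    then show False
      using \<xi>0'(3) by simp
  qed
qed

text \<open>Because harmonics of degree \<open>j\<close> have parity \<open>(-1)\<^sup>j\<close>, even degrees see only the even part
  of \<open>c\<close> and odd degrees only its odd part. Each part is determined by infinitely many degrees of its
  own parity.\<close>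

lemma harmonic_annihilator_trivial:
  fixes c :: "real^3 \<Rightarrow> complex"
  assumes "finite \<Xi>" "\<Xi> \<subseteq> S2"
    and "infinite {j \<in> J. even j}" "infinite {j \<in> J. odd j}"
    and zero: "\<And>j l. j \<in> J \<Longrightarrow> l \<le> j \<Longrightarrow> (\<Sum>\<xi>\<in>\<Xi>. c \<xi> * unnormalized_harm j l \<xi>) = 0"
  shows "\<forall>\<xi>\<in>\<Xi>. c \<xi> = 0"
proof
  define X where "X = \<Xi> \<union> uminus ` \<Xi>"
  define c' where "c' \<xi> = (if \<xi> \<in> \<Xi> then c \<xi> else 0)" for \<xi>
  have X: "finite X" "X \<subseteq> S2" "\<And>\<xi>. \<xi> \<in> X \<Longrightarrow> - \<xi> \<in> X"
    using assms(1,2) by (auto simp: X_def)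
  have zero': "(\<Sum>\<xi>\<in>X. c' \<xi> * unnormalized_harm j l \<xi>) = 0" if "j \<in> J" "l \<le> j" for j l
  proof -
    have "(\<Sum>\<xi>\<in>X. c' \<xi> * unnormalized_harm j l \<xi>) = (\<Sum>\<xi>\<in>\<Xi>. c \<xi> * unnormalized_harm j l \<xi>)"
      using X(1) by (intro sum.mono_neutral_cong_right) (auto simp: X_def c'_def)
    then show ?thesis
      using zero[OF that] by simp
  qed
  have reflect: "(\<Sum>\<xi>\<in>X. c' (- \<xi>) * unnormalized_harm j l \<xi>) = 0" if "j \<in> J" "l \<le> j" for j l
  proof -
    have "(\<Sum>\<xi>\<in>X. c' (- \<xi>) * unnormalized_harm j l \<xi>)
        = (\<Sum>\<xi>\<in>X. c' \<xi> * unnormalized_harm j l (- \<xi>))"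
      using X(3) by (intro sum.reindex_bij_witness[of _ uminus uminus]) auto
    also have "\<dots> = (-1) ^ j * (\<Sum>\<xi>\<in>X. c' \<xi> * unnormalized_harm j l \<xi>)"
      using that by (simp add: unnormalized_harm_minus sum_distrib_left mult_ac)
    finally show ?thesis
      using zero'[OF that] by simp
  qed
  have parity: "\<forall>\<xi>\<in>X. c' \<xi> + \<sigma> * c' (- \<xi>) = 0"
    if "infinite J'" "J' \<subseteq> J" "\<And>j. j \<in> J' \<Longrightarrow> (-1) ^ j = \<sigma>" "\<sigma> * \<sigma> = 1" for \<sigma> J'
  proof (rule equivariant_coefficients_vanish[OF X, where J = J' and \<sigma> = \<sigma>])
    show "(\<Sum>\<xi>\<in>X. (c' \<xi> + \<sigma> * c' (- \<xi>)) * unnormalized_harm j l \<xi>) = 0" if "j \<in> J'" "l \<le> j" for j l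
    proof -
      have "(\<Sum>\<xi>\<in>X. (c' \<xi> + \<sigma> * c' (- \<xi>)) * unnormalized_harm j l \<xi>)
          = (\<Sum>\<xi>\<in>X. c' \<xi> * unnormalized_harm j l \<xi>)
            + \<sigma> * (\<Sum>\<xi>\<in>X. c' (- \<xi>) * unnormalized_harm j l \<xi>)"
        by (simp add: distrib_right sum.distrib sum_distrib_left mult.assoc)
      then show ?thesis
        using zero' reflect that \<open>J' \<subseteq> J\<close> by auto
    qed
  qed (use that in \<open>auto simp: distrib_left simp flip: mult.assoc\<close>)
  fix \<xi> assume "\<xi> \<in> \<Xi>"
  then have "c' \<xi> + 1 * c' (- \<xi>) = 0" "c' \<xi> + (-1) * c' (- \<xi>) = 0"
    using parity[of "{j \<in> J. even j}" 1] parity[of "{j \<in> J. odd j}" "-1"] assms(3,4)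
    by (auto simp: X_def)
  then have "c' \<xi> = 0"
    by (simp add: eq_neg_iff_add_eq_0)
  then show "c \<xi> = 0"
    using \<open>\<xi> \<in> \<Xi>\<close> by (simp add: c'_def)
qed

section \<open>Integrals of positive definite kernels\<close>

lemma space_surface_measure [simp]: "space surface_measure = S2"
  by (simp add: surface_measure_def space_restrict_space)

lemma sets_surface_measure: "sets surface_measure = sets (restrict_space borel S2)"
  by (simp add: surface_measure_def)

lemma continuous_on_spherical_point: "continuous_on S (\<lambda>(\<theta>, \<phi>). spherical_point \<theta> \<phi>)"
proof -
  have "continuous_on S (\<lambda>p. spherical_point (fst p) (snd p) $ i)" for i
    unfolding spherical_point_def
    by (rule disjE[OF exhaust_3[of i]]; (elim disjE)?) (simp_all, (intro continuous_intros)+)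
  then have "continuous_on S (\<lambda>p. \<chi> i. spherical_point (fst p) (snd p) $ i)"
    by (rule continuous_on_vec_lambda)
  then show ?thesis
    by (simp add: case_prod_unfold)
qed

lemma spherical_point_in_sphere: "spherical_point \<theta> \<phi> \<in> S2"
proof -
  have "(sin \<theta> * cos \<phi>)\<^sup>2 + (sin \<theta> * sin \<phi>)\<^sup>2 = (sin \<theta>)\<^sup>2 * ((cos \<phi>)\<^sup>2 + (sin \<phi>)\<^sup>2)"
    by (simp only: power_mult_distrib distrib_left)
  then have "(sin \<theta> * cos \<phi>)\<^sup>2 + (sin \<theta> * sin \<phi>)\<^sup>2 + (cos \<theta>)\<^sup>2 = 1"
    by simp
  then have "norm (spherical_point \<theta> \<phi>) = 1"
    unfolding norm_eq_1 by (simp add: spherical_point_def inner_vec_def sum_3 power2_eq_square)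
  then show ?thesis
    by simp
qed

lemma finite_measure_surface_measure: "finite_measure surface_measure"
proof -
  let ?R = "restrict_space lborel ({0..pi} \<times> {0..2 * pi})"
  let ?D = "density ?R (\<lambda>(\<theta>, \<phi>). ennreal (sin \<theta>))"
  have box: "{0..pi} \<times> {0..2 * pi} = cbox (0, 0) (pi, 2 * pi)"
    by (simp add: cbox_Pair_eq)
  have "(\<lambda>(\<theta>, \<phi>). ennreal (sin \<theta>)) \<in> borel_measurable (borel :: (real \<times> real) measure)"
    unfolding borel_prod[symmetric] by measurable
  then have sin: "(\<lambda>(\<theta>, \<phi>). ennreal (sin \<theta>)) \<in> borel_measurable ?R"
    by (intro measurable_restrict_space1) simp
  have "emeasure ?D (space ?D) = (\<integral>\<^sup>+p. (\<lambda>(\<theta>, \<phi>). ennreal (sin \<theta>)) p * indicator (space ?R) p \<partial>?R)"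
    using emeasure_density[OF sin sets.top] by simp
  also have "\<dots> \<le> (\<integral>\<^sup>+p. 1 \<partial>?R)"
    by (intro nn_integral_mono) (auto simp: indicator_def)
  also have "\<dots> = emeasure lborel (cbox (0 :: real, 0 :: real) (pi, 2 * pi))"
    by (simp add: box emeasure_restrict_space space_restrict_space)
  also have "\<dots> < \<infinity>"
    by (rule emeasure_lborel_cbox_finite)
  finally interpret finite_measure ?D
    by (intro finite_measureI) simp
  have "(\<lambda>(\<theta>, \<phi>). spherical_point \<theta> \<phi>) \<in> borel_measurable ?R"
    by (intro measurable_restrict_space1) (simp add: borel_measurable_continuous_onI continuous_on_spherical_point)
  then have "(\<lambda>(\<theta>, \<phi>). spherical_point \<theta> \<phi>) \<in> measurable ?D (restrict_space borel S2)"
    by (intro measurable_restrict_space2) (auto simp: spherical_point_in_sphere simp del: mem_sphere_0 mem_sphere)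
  then show ?thesis
    unfolding surface_measure_def by (rule finite_measure_distr)
qed

lemma continuous_on_sphere_measurable:
  "continuous_on S2 f \<Longrightarrow> f \<in> borel_measurable surface_measure"
  using borel_measurable_continuous_on_restrict measurable_cong_sets[OF sets_surface_measure refl]
  by blast

text \<open>The identity is approximated by simple functions into the ambient space, and these are projected
  back to the sphere by normalization. The value \<open>0\<close>, which has no direction, is sent to an arbitrary
  point of the sphere and occurs only finitely often at each point.\<close>

lemma sphere_simple_approximation:
  obtains s :: "nat \<Rightarrow> real^3 \<Rightarrow> real^3"
  where "\<And>n. s n \<in> borel_measurable surface_measure"
    and "\<And>n. finite (s n ` S2)"
    and "\<And>n \<xi>. s n \<xi> \<in> S2"
    and "\<And>\<xi>. \<xi> \<in> S2 \<Longrightarrow> (\<lambda>n. s n \<xi>) \<longlonglongrightarrow> \<xi>"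
proof -
  have "(\<lambda>\<xi>. \<xi>) \<in> borel_measurable surface_measure"
    by (intro continuous_on_sphere_measurable continuous_intros)
  from borel_measurable_implies_sequence_metric[OF this, of 0]
  obtain F where F: "\<And>n. simple_function surface_measure (F n)"
    and lim: "\<And>\<xi>. \<xi> \<in> S2 \<Longrightarrow> (\<lambda>n. F n \<xi>) \<longlonglongrightarrow> \<xi>"
    by (metis space_surface_measure)
  define r :: "real^3 \<Rightarrow> real^3" where "r v = (if v = 0 then axis 1 1 else sgn v)" for v
  have simple: "simple_function surface_measure (\<lambda>\<xi>. r (F n \<xi>))" for n
    using F by (rule simple_function_compose1)
  show thesis
  proof (rule that[of "\<lambda>n \<xi>. r (F n \<xi>)"])
    show "(\<lambda>\<xi>. r (F n \<xi>)) \<in> borel_measurable surface_measure" for n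
      using simple by (rule borel_measurable_simple_function)
    show "finite ((\<lambda>\<xi>. r (F n \<xi>)) ` S2)" for n
      using simple_functionD(1)[OF simple] by simp
    show "r (F n \<xi>) \<in> S2" for n \<xi>
      by (simp add: r_def norm_sgn)
  next
    fix \<xi> :: "real^3" assume "\<xi> \<in> S2"
    then have "\<xi> \<noteq> 0" "sgn \<xi> = \<xi>"
      by (auto simp: sgn_div_norm)
    have "\<forall>\<^sub>F n in sequentially. F n \<xi> \<noteq> 0"
      using lim[OF \<open>\<xi> \<in> S2\<close>] \<open>\<xi> \<noteq> 0\<close> by (rule tendsto_imp_eventually_ne)
    then have "\<forall>\<^sub>F n in sequentially. sgn (F n \<xi>) = r (F n \<xi>)"
      by eventually_elim (simp add: r_def)
    moreover have "(\<lambda>n. sgn (F n \<xi>)) \<longlonglongrightarrow> sgn \<xi>"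
      using lim[OF \<open>\<xi> \<in> S2\<close>] \<open>\<xi> \<noteq> 0\<close> by (rule tendsto_sgn)
    ultimately show "(\<lambda>n. r (F n \<xi>)) \<longlonglongrightarrow> \<xi>"
      using \<open>sgn \<xi> = \<xi>\<close> by (simp add: Lim_transform_eventually)
  qed
qed

lemma integral_product_bounded:
  fixes f g :: "'a \<Rightarrow> complex"
  assumes "finite_measure M"
    and [measurable]: "f \<in> borel_measurable M" "g \<in> borel_measurable M"
    and bnd: "\<And>x. x \<in> space M \<Longrightarrow> cmod (f x) \<le> B" "\<And>x. x \<in> space M \<Longrightarrow> cmod (g x) \<le> C"
  shows "integrable (M \<Otimes>\<^sub>M M) (\<lambda>p. f (fst p) * g (snd p))"
    and "(LINT p|(M \<Otimes>\<^sub>M M). f (fst p) * g (snd p)) = (LINT x|M. f x) * (LINT x|M. g x)"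
proof -
  interpret M: finite_measure M by fact
  interpret P: pair_sigma_finite M M ..
  interpret MM: finite_measure "M \<Otimes>\<^sub>M M"
    using finite_measure_pair_measure[OF assms(1) assms(1)] .
  show int: "integrable (M \<Otimes>\<^sub>M M) (\<lambda>p. f (fst p) * g (snd p))"
  proof (rule MM.integrable_const_bound[where B = "B * C"])
    show "AE p in M \<Otimes>\<^sub>M M. cmod (f (fst p) * g (snd p)) \<le> B * C"
    proof (rule AE_I2)
      fix p assume "p \<in> space (M \<Otimes>\<^sub>M M)"
      then have "cmod (f (fst p)) \<le> B" "cmod (g (snd p)) \<le> C"
        using bnd by (auto simp: space_pair_measure)
      moreover from this have "0 \<le> B"
        using norm_ge_zero order_trans by blast
      ultimately show "cmod (f (fst p) * g (snd p)) \<le> B * C"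
        unfolding norm_mult by (intro mult_mono norm_ge_zero)
    qed
  qed measurable
  from P.integral_fst'[OF this]
  show "(LINT p|(M \<Otimes>\<^sub>M M). f (fst p) * g (snd p)) = (LINT x|M. f x) * (LINT x|M. g x)"
    by simp
qed

lemma bounded_on_sphere:
  fixes g :: "real^3 \<Rightarrow> complex"
  assumes "continuous_on S2 g"
  obtains B where "\<And>\<xi>. \<xi> \<in> S2 \<Longrightarrow> cmod (g \<xi>) \<le> B"
proof -
  have "compact (g ` S2)"
    using assms by (intro compact_continuous_image) auto
  then obtain B where "\<forall>z\<in>g ` S2. norm z \<le> B"
    using compact_imp_bounded bounded_iff by metis
  then show thesis
    using that by blast
qed

text \<open>Replacing \<open>K(\<xi>, \<zeta>)\<close> by \<open>K(s \<xi>, s \<zeta>)\<close> with a simple function \<open>s\<close> from the sphere to itself turns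
  double integrals into finite sums over the values of \<open>s\<close>.\<close>

locale continuous_sphere_kernel =
  fixes K :: "real^3 \<Rightarrow> real^3 \<Rightarrow> complex"
  assumes continuous_kernel: "continuous_on (S2 \<times> S2) (\<lambda>(\<xi>, \<zeta>). K \<xi> \<zeta>)"
begin

abbreviation SS where "SS \<equiv> surface_measure \<Otimes>\<^sub>M surface_measure"

lemma kernel_bounded:
  obtains B where "\<And>\<xi> \<zeta>. \<xi> \<in> S2 \<Longrightarrow> \<zeta> \<in> S2 \<Longrightarrow> cmod (K \<xi> \<zeta>) \<le> B"
proof -
  have "compact ((\<lambda>(\<xi>, \<zeta>). K \<xi> \<zeta>) ` (S2 \<times> S2))"
    by (intro compact_continuous_image continuous_kernel compact_Times compact_sphere)
  then obtain B where "\<forall>z\<in>(\<lambda>(\<xi>, \<zeta>). K \<xi> \<zeta>) ` (S2 \<times> S2). norm z \<le> B"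
    using compact_imp_bounded bounded_iff by metis
  then show thesis
    by (intro that[of B]) blast
qed

lemma kernel_tendsto:
  fixes s :: "nat \<Rightarrow> real^3 \<Rightarrow> real^3"
  assumes "\<xi> \<in> S2" "\<zeta> \<in> S2" "\<And>n. s n \<xi> \<in> S2" "\<And>n. s n \<zeta> \<in> S2"
    and "(\<lambda>n. s n \<xi>) \<longlonglongrightarrow> \<xi>" "(\<lambda>n. s n \<zeta>) \<longlonglongrightarrow> \<zeta>"
  shows "(\<lambda>n. K (s n \<xi>) (s n \<zeta>)) \<longlonglongrightarrow> K \<xi> \<zeta>"
proof -
  have "(\<lambda>n. (\<lambda>(\<xi>, \<zeta>). K \<xi> \<zeta>) (s n \<xi>, s n \<zeta>)) \<longlonglongrightarrow> (\<lambda>(\<xi>, \<zeta>). K \<xi> \<zeta>) (\<xi>, \<zeta>)"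
    using assms
    by (intro continuous_on_tendsto_compose[OF continuous_kernel] tendsto_Pair) auto
  then show ?thesis
    by simp
qed

lemma discretized_kernel_eq:
  fixes s :: "real^3 \<Rightarrow> real^3" and f h :: "real^3 \<Rightarrow> complex"
  assumes "finite P" "s \<xi> \<in> P" "s \<zeta> \<in> P"
  shows "K (s \<xi>) (s \<zeta>) * f \<xi> * h \<zeta>
    = (\<Sum>a\<in>P. \<Sum>b\<in>P. K a b * ((if s \<xi> = a then f \<xi> else 0) * (if s \<zeta> = b then h \<zeta> else 0)))"
proof -
  have "(\<Sum>a\<in>P. \<Sum>b\<in>P. K a b * ((if s \<xi> = a then f \<xi> else 0) * (if s \<zeta> = b then h \<zeta> else 0)))
      = (\<Sum>a\<in>P. \<Sum>b\<in>P. if b = s \<zeta> then (if a = s \<xi> then K a b * f \<xi> * h \<zeta> else 0) else 0)"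
    by (intro sum.cong refl) auto
  also have "\<dots> = K (s \<xi>) (s \<zeta>) * f \<xi> * h \<zeta>"
    using assms by simp
  finally show ?thesis ..
qed

lemma discretized_kernel:
  fixes s :: "real^3 \<Rightarrow> real^3" and f h :: "real^3 \<Rightarrow> complex"
  assumes s: "s \<in> borel_measurable surface_measure" "finite (s ` S2)"
    and f: "continuous_on S2 f" and h: "continuous_on S2 h"
  defines "piece \<equiv> (\<lambda>a (g :: real^3 \<Rightarrow> complex) \<xi>. if s \<xi> = a then g \<xi> else 0)"
  shows "(\<lambda>p. K (s (fst p)) (s (snd p)) * f (fst p) * h (snd p)) \<in> borel_measurable SS"
    and "(LINT p|SS. K (s (fst p)) (s (snd p)) * f (fst p) * h (snd p))
      = (\<Sum>a\<in>s ` S2. \<Sum>b\<in>s ` S2. K a b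
          * ((LINT \<xi>|surface_measure. piece a f \<xi>) * (LINT \<xi>|surface_measure. piece b h \<xi>)))"
proof -
  obtain B C where B: "\<And>\<xi>. \<xi> \<in> S2 \<Longrightarrow> cmod (f \<xi>) \<le> B" and C: "\<And>\<xi>. \<xi> \<in> S2 \<Longrightarrow> cmod (h \<xi>) \<le> C"
    using bounded_on_sphere[OF f] bounded_on_sphere[OF h] by metis
  have piece_measurable: "piece a f \<in> borel_measurable surface_measure"
    "piece a h \<in> borel_measurable surface_measure" for a
  proof -
    have "s -` {a} \<inter> space surface_measure \<in> sets surface_measure"
      using s(1) by (rule measurable_sets) simp
    then have "(\<lambda>\<xi>. if \<xi> \<in> s -` {a} then g \<xi> else 0) \<in> borel_measurable surface_measure"
      if "continuous_on S2 g" for g :: "real^3 \<Rightarrow> complex"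
      using continuous_on_sphere_measurable[OF that] by (intro measurable_If_set) auto
    then show "piece a f \<in> borel_measurable surface_measure"
      "piece a h \<in> borel_measurable surface_measure"
      using f h by (simp_all add: piece_def)
  qed
  have piece_bound: "cmod (piece a f \<xi>) \<le> B" "cmod (piece a h \<xi>) \<le> C"
    if "\<xi> \<in> space surface_measure" for a \<xi>
  proof -
    have "\<xi> \<in> S2"
      using that by (simp only: space_surface_measure)
    note B[OF this] C[OF this]
    moreover from this have "0 \<le> B" "0 \<le> C"
      using norm_ge_zero order_trans by blast+
    ultimately show "cmod (piece a f \<xi>) \<le> B" "cmod (piece a h \<xi>) \<le> C"
      unfolding piece_def by simp_all
  qed
  note product = integral_product_bounded[OF finite_measure_surface_measure
      piece_measurable(1) piece_measurable(2) piece_bound]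
  have eq: "K (s (fst p)) (s (snd p)) * f (fst p) * h (snd p)
      = (\<Sum>a\<in>s ` S2. \<Sum>b\<in>s ` S2. K a b * (piece a f (fst p) * piece b h (snd p)))" if "p \<in> space SS" for p
  proof -
    have "s (fst p) \<in> s ` S2" "s (snd p) \<in> s ` S2"
      using that by (auto simp only: space_pair_measure space_surface_measure mem_Times_iff)
    from discretized_kernel_eq[where s = s and \<xi> = "fst p" and \<zeta> = "snd p" and f = f and h = h, OF s(2) this] show ?thesis
      by (simp only: piece_def)
  qed
  have expansion: "has_bochner_integral SS
      (\<lambda>p. \<Sum>a\<in>s ` S2. \<Sum>b\<in>s ` S2. K a b * (piece a f (fst p) * piece b h (snd p)))
      (\<Sum>a\<in>s ` S2. \<Sum>b\<in>s ` S2. K a b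
          * ((LINT \<xi>|surface_measure. piece a f \<xi>) * (LINT \<xi>|surface_measure. piece b h \<xi>)))"
    using product
    by (intro has_bochner_integral_sum has_bochner_integral_mult_right)
      (simp only: has_bochner_integral_iff simp_thms)
  show "(\<lambda>p. K (s (fst p)) (s (snd p)) * f (fst p) * h (snd p)) \<in> borel_measurable SS"
    using borel_measurable_has_bochner_integral[OF expansion] by (subst measurable_cong[OF eq])
  have "(LINT p|SS. K (s (fst p)) (s (snd p)) * f (fst p) * h (snd p))
      = (LINT p|SS. (\<Sum>a\<in>s ` S2. \<Sum>b\<in>s ` S2. K a b * (piece a f (fst p) * piece b h (snd p))))"
    by (intro Bochner_Integration.integral_cong refl eq)
  then show "(LINT p|SS. K (s (fst p)) (s (snd p)) * f (fst p) * h (snd p))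
      = (\<Sum>a\<in>s ` S2. \<Sum>b\<in>s ` S2. K a b
          * ((LINT \<xi>|surface_measure. piece a f \<xi>) * (LINT \<xi>|surface_measure. piece b h \<xi>)))"
    using has_bochner_integral_integral_eq[OF expansion] by (rule trans)
qed

text \<open>The discretized kernels provide both the measurability of \<open>K\<close> for the product \<open>\<sigma>\<close>-algebra and, by
  dominated convergence, the value of the integral.\<close>

lemma kernel_integrable:
  fixes f h :: "real^3 \<Rightarrow> complex" and s :: "nat \<Rightarrow> real^3 \<Rightarrow> real^3"
  assumes f: "continuous_on S2 f" and h: "continuous_on S2 h"
  shows "integrable SS (\<lambda>p. K (fst p) (snd p) * f (fst p) * h (snd p))" (is ?int)
    and "\<lbrakk>\<And>n. s n \<in> borel_measurable surface_measure; \<And>n. finite (s n ` S2); \<And>n \<xi>. s n \<xi> \<in> S2;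
        \<And>\<xi>. \<xi> \<in> S2 \<Longrightarrow> (\<lambda>n. s n \<xi>) \<longlonglongrightarrow> \<xi>\<rbrakk> \<Longrightarrow>
      (\<lambda>n. LINT p|SS. K (s n (fst p)) (s n (snd p)) * f (fst p) * h (snd p))
      \<longlonglongrightarrow> (LINT p|SS. K (fst p) (snd p) * f (fst p) * h (snd p))"
proof -
  interpret MM: finite_measure SS
    using finite_measure_pair_measure[OF finite_measure_surface_measure finite_measure_surface_measure] .
  obtain A B C where A: "\<And>\<xi> \<zeta>. \<xi> \<in> S2 \<Longrightarrow> \<zeta> \<in> S2 \<Longrightarrow> cmod (K \<xi> \<zeta>) \<le> A"
    and B: "\<And>\<xi>. \<xi> \<in> S2 \<Longrightarrow> cmod (f \<xi>) \<le> B" and C: "\<And>\<xi>. \<xi> \<in> S2 \<Longrightarrow> cmod (h \<xi>) \<le> C"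
    using bounded_on_sphere[OF f] bounded_on_sphere[OF h] kernel_bounded by metis
  have bound: "cmod (K \<xi>' \<zeta>' * f \<xi> * h \<zeta>) \<le> A * B * C"
    if "\<xi>' \<in> S2" "\<zeta>' \<in> S2" "\<xi> \<in> S2" "\<zeta> \<in> S2" for \<xi>' \<zeta>' \<xi> \<zeta>
    using A[OF that(1,2)] B[OF that(3)] C[OF that(4)]
      order_trans[OF norm_ge_zero A[OF that(1,2)]] order_trans[OF norm_ge_zero B[OF that(3)]]
    unfolding norm_mult by (intro mult_mono mult_nonneg_nonneg norm_ge_zero)
  have measurable: "(\<lambda>p. K (fst p) (snd p) * f (fst p) * h (snd p)) \<in> borel_measurable SS"
    if s: "\<And>n. s n \<in> borel_measurable surface_measure" "\<And>n. finite (s n ` S2)" "\<And>n \<xi>. s n \<xi> \<in> S2"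
      "\<And>\<xi>. \<xi> \<in> S2 \<Longrightarrow> (\<lambda>n. s n \<xi>) \<longlonglongrightarrow> \<xi>" for s
  proof (rule borel_measurable_LIMSEQ_metric)
    show "(\<lambda>p. K (s n (fst p)) (s n (snd p)) * f (fst p) * h (snd p)) \<in> borel_measurable SS" for n
      using s f h by (intro discretized_kernel)
    show "(\<lambda>n. K (s n (fst p)) (s n (snd p)) * f (fst p) * h (snd p))
        \<longlonglongrightarrow> K (fst p) (snd p) * f (fst p) * h (snd p)" if "p \<in> space SS" for p
      using that s(3,4) by (intro tendsto_intros kernel_tendsto) (auto simp: space_pair_measure simp del: mem_sphere_0 mem_sphere)
  qed
  obtain s0 :: "nat \<Rightarrow> real^3 \<Rightarrow> real^3" where
    "\<And>n. s0 n \<in> borel_measurable surface_measure" "\<And>n. finite (s0 n ` S2)" "\<And>n \<xi>. s0 n \<xi> \<in> S2"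
    "\<And>\<xi>. \<xi> \<in> S2 \<Longrightarrow> (\<lambda>n. s0 n \<xi>) \<longlonglongrightarrow> \<xi>"
    by (rule sphere_simple_approximation) blast
  from measurable[OF this] show ?int
    by (rule MM.integrable_const_bound[rotated, where B = "A * B * C"])
      (auto simp: space_pair_measure simp del: mem_sphere_0 mem_sphere intro!: AE_I2 bound)
  then have meas: "(\<lambda>p. K (fst p) (snd p) * f (fst p) * h (snd p)) \<in> borel_measurable SS"
    by (rule borel_measurable_integrable)
  assume s: "\<And>n. s n \<in> borel_measurable surface_measure" "\<And>n. finite (s n ` S2)" "\<And>n \<xi>. s n \<xi> \<in> S2"
    "\<And>\<xi>. \<xi> \<in> S2 \<Longrightarrow> (\<lambda>n. s n \<xi>) \<longlonglongrightarrow> \<xi>"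
  show "(\<lambda>n. LINT p|SS. K (s n (fst p)) (s n (snd p)) * f (fst p) * h (snd p))
      \<longlonglongrightarrow> (LINT p|SS. K (fst p) (snd p) * f (fst p) * h (snd p))"
  proof (rule integral_dominated_convergence[where w = "\<lambda>_. A * B * C"])
    show "(\<lambda>p. K (s n (fst p)) (s n (snd p)) * f (fst p) * h (snd p)) \<in> borel_measurable SS" for n
      using s f h by (intro discretized_kernel)
    show "AE p in SS. (\<lambda>n. K (s n (fst p)) (s n (snd p)) * f (fst p) * h (snd p))
        \<longlonglongrightarrow> K (fst p) (snd p) * f (fst p) * h (snd p)"
      using s(3,4) by (intro AE_I2 tendsto_intros kernel_tendsto) (auto simp: space_pair_measure simp del: mem_sphere_0 mem_sphere)
    show "AE p in SS. cmod (K (s n (fst p)) (s n (snd p)) * f (fst p) * h (snd p)) \<le> A * B * C" for n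
      using s(3) by (intro AE_I2 bound) (auto simp: space_pair_measure simp del: mem_sphere_0 mem_sphere)
  qed (use meas in auto)
qed

text \<open>After discretization the integral is the quadratic form of \<open>K\<close> on the finitely many values of \<open>s\<close>, at
  the vector of integrals of \<open>g\<close> over the corresponding pieces of the sphere.\<close>

lemma kernel_form_nonneg:
  fixes g :: "real^3 \<Rightarrow> complex"
  assumes pd: "positive_definite_kernel K" and g: "continuous_on S2 g"
  shows "0 \<le> Re (LINT p|SS. K (fst p) (snd p) * cnj (g (fst p)) * g (snd p))"
proof -
  obtain s :: "nat \<Rightarrow> real^3 \<Rightarrow> real^3" where
    s: "\<And>n. s n \<in> borel_measurable surface_measure" "\<And>n. finite (s n ` S2)" "\<And>n \<xi>. s n \<xi> \<in> S2"
    "\<And>\<xi>. \<xi> \<in> S2 \<Longrightarrow> (\<lambda>n. s n \<xi>) \<longlonglongrightarrow> \<xi>"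
    by (rule sphere_simple_approximation) blast
  have cg: "continuous_on S2 (\<lambda>\<xi>. cnj (g \<xi>))"
    using g by (intro continuous_intros)
  let ?I = "\<lambda>n. LINT p|SS. K (s n (fst p)) (s n (snd p)) * cnj (g (fst p)) * g (snd p)"
  have "0 \<le> Re (?I n)" for n
  proof -
    let ?P = "s n ` S2"
    define G where "G a = (LINT \<xi>|surface_measure. (if s n \<xi> = a then g \<xi> else 0))" for a
    define x where "x = restrict G ?P"
    have "(LINT \<xi>|surface_measure. (if s n \<xi> = a then cnj (g \<xi>) else 0)) = cnj (G a)" for a
    proof -
      have "(LINT \<xi>|surface_measure. (if s n \<xi> = a then cnj (g \<xi>) else 0))
          = (LINT \<xi>|surface_measure. cnj (if s n \<xi> = a then g \<xi> else 0))"
        by (intro Bochner_Integration.integral_cong) auto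
      then show ?thesis
        by (simp only: G_def Bochner_Integration.integral_cnj)
    qed
    then have "?I n = (\<Sum>a\<in>?P. \<Sum>b\<in>?P. K a b * (cnj (G a) * G b))"
      using discretized_kernel(2)[OF s(1,2) cg g, of n] by (simp only: G_def)
    also have "\<dots> = coord_inner ?P (kernel_operator K ?P x) x"
      by (simp add: coord_inner_def kernel_operator_def x_def sum_distrib_left sum_distrib_right mult_ac)
    finally have "?I n = coord_inner ?P (kernel_operator K ?P x) x" .
    moreover have "positive_operator_on ?P (kernel_operator K ?P)"
      using pd s(2,3) unfolding positive_definite_kernel_def by blast
    then have "0 \<le> coord_inner ?P (kernel_operator K ?P x) x"
      unfolding positive_operator_on_def by (auto simp: x_def)
    ultimately show ?thesis
      by (simp add: less_eq_complex_def)
  qed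
  moreover have "(\<lambda>n. Re (?I n)) \<longlonglongrightarrow> Re (LINT p|SS. K (fst p) (snd p) * cnj (g (fst p)) * g (snd p))"
    by (intro tendsto_Re kernel_integrable(2)[OF cg g] s)
  ultimately show ?thesis
    by (intro LIMSEQ_le_const) auto
qed

end

section \<open>Quadratic forms of the kernel and of its blocks\<close>

text \<open>The quadratic form of the operator \<open>D\<^sub>j\<close>, with vectors indexed by the orders \<open>-j, \<dots>, j\<close>.\<close>

definition block_form ::
    "(nat \<Rightarrow> int \<Rightarrow> int \<Rightarrow> complex) \<Rightarrow> nat \<Rightarrow> (int \<Rightarrow> complex) \<Rightarrow> complex"
  where "block_form d j a = (\<Sum>k=-int j..int j. \<Sum>k'=-int j..int j. d j k k' * a k * cnj (a k'))"

lemma coord_inner_block_operator: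
  fixes a :: "int \<Rightarrow> complex" and j :: nat
  defines "x \<equiv> (\<lambda>i\<in>{1..2 * j + 1}. a (int i - int j - 1))"
  shows "coord_inner {1..2 * j + 1} (block_operator d j x) x = block_form d j a"
proof -
  have reindex: "(\<Sum>i=1..2 * j + 1. f (int i - int j - 1)) = (\<Sum>k=-int j..int j. f k)"
    for f :: "int \<Rightarrow> complex"
    by (intro sum.reindex_bij_witness[of _ "\<lambda>k. nat (k + int j + 1)" "\<lambda>i. int i - int j - 1"]) auto
  have "coord_inner {1..2 * j + 1} (block_operator d j x) x
      = (\<Sum>i'=1..2 * j + 1. (\<Sum>i=1..2 * j + 1. d j (int i - int j - 1) (int i' - int j - 1)
          * a (int i - int j - 1)) * cnj (a (int i' - int j - 1)))"
    unfolding coord_inner_def block_operator_def x_def by (intro sum.cong refl) simp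
  also have "\<dots> = (\<Sum>k'=-int j..int j. (\<Sum>k=-int j..int j. d j k k' * a k) * cnj (a k'))"
    unfolding reindex[of "\<lambda>k. d j k k' * a k" for k']
      reindex[of "\<lambda>k'. (\<Sum>k=-int j..int j. d j k k' * a k) * cnj (a k')"] ..
  also have "\<dots> = block_form d j a"
    unfolding block_form_def sum_distrib_right by (rule sum.swap)
  finally show ?thesis .
qed

lemma block_form_pos:
  assumes "j \<in> strictly_positive_degrees d" "k \<in> {- int j..int j}" "a k \<noteq> 0"
  shows "0 < Re (block_form d j a)"
proof -
  let ?I = "{1..2 * j + 1}"
  let ?x = "\<lambda>i\<in>?I. a (int i - int j - 1)"
  have "?x \<noteq> (\<lambda>i\<in>?I. 0)"
  proof
    assume eq: "?x = (\<lambda>i\<in>?I. 0)"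
    from assms(2) have "nat (k + int j + 1) \<in> ?I"
      by auto
    with fun_cong[OF eq, of "nat (k + int j + 1)"] assms(2,3) show False
      by simp
  qed
  then have "0 < coord_inner ?I (block_operator d j ?x) ?x"
    using assms(1) by (simp add: strictly_positive_degrees_def strictly_positive_operator_on_def)
  then show ?thesis
    by (simp only: coord_inner_block_operator less_complex_def zero_complex.sel)
qed

text \<open>The value of the form is \<open>\<integral>\<integral> K(\<xi>, \<zeta>) cnj (g \<xi>) g \<zeta>\<close> for the harmonic \<open>g\<close> of degree \<open>j\<close> with coefficients
  \<open>cnj (a k)\<close>. Hence all blocks are positive semidefinite, including those outside the strictly
  positive degrees.\<close>

lemma (in continuous_sphere_kernel) block_form_nonneg:
  assumes "positive_definite_kernel K" "has_block_expansion K d"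
  shows "0 \<le> Re (block_form d j a)"
proof -
  let ?I = "{- int j..int j}"
  define g where "g \<xi> = (\<Sum>k\<in>?I. cnj (a k) * sph_harm j k \<xi>)" for \<xi>
  have g: "continuous_on S2 g"
    unfolding g_def by (intro continuous_intros continuous_on_sph_harm)
  let ?f = "\<lambda>k k' p. K (fst p) (snd p) * cnj (sph_harm j k (fst p)) * sph_harm j k' (snd p)"
  have int: "integrable SS (?f k k')" if "k \<in> ?I" "k' \<in> ?I" for k k'
    using that by (intro kernel_integrable(1) continuous_intros continuous_on_sph_harm)
  have "block_form d j a = (\<Sum>k\<in>?I. \<Sum>k'\<in>?I. (LINT p|SS. ?f k k' p) * a k * cnj (a k'))"
    unfolding block_form_def
  proof (intro sum.cong refl)
    fix k k' assume "k \<in> ?I" "k' \<in> ?I"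
    then have "d j k k' = sph_coeff K j j k k'"
      using assms(2) unfolding has_block_expansion_def by auto
    then show "d j k k' * a k * cnj (a k') = (LINT p|SS. ?f k k' p) * a k * cnj (a k')"
      by (simp add: sph_coeff_def mult.assoc)
  qed
  also have "\<dots> = (LINT p|SS. (\<Sum>k\<in>?I. \<Sum>k'\<in>?I. ?f k k' p * a k * cnj (a k')))"
    by (intro has_bochner_integral_integral_eq[symmetric] has_bochner_integral_sum
        has_bochner_integral_mult_left has_bochner_integral_integrable int)
  also have "\<dots> = (LINT p|SS. K (fst p) (snd p) * cnj (g (fst p)) * g (snd p))"
    by (intro Bochner_Integration.integral_cong refl)
      (simp add: g_def sum_distrib_left sum_distrib_right mult_ac)
  finally show ?thesis
    using kernel_form_nonneg[OF assms(1) g] by simp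
qed

lemma kernel_quadratic_form_sums:
  assumes "has_block_expansion K d" "\<Xi> \<subseteq> S2"
  shows "(\<lambda>j. block_form d j (\<lambda>k. \<Sum>\<xi>\<in>\<Xi>. cnj (x \<xi>) * sph_harm j k \<xi>))
    sums coord_inner \<Xi> (kernel_operator K \<Xi> x) x"
proof -
  let ?t = "\<lambda>\<xi> \<zeta> j. \<Sum>k=-int j..int j. \<Sum>k'=-int j..int j. d j k k' * sph_harm j k \<xi> * cnj (sph_harm j k' \<zeta>)"
  have "(\<lambda>j. \<Sum>\<xi>\<in>\<Xi>. \<Sum>\<zeta>\<in>\<Xi>. ?t \<xi> \<zeta> j * (x \<zeta> * cnj (x \<xi>)))
      sums (\<Sum>\<xi>\<in>\<Xi>. \<Sum>\<zeta>\<in>\<Xi>. K \<xi> \<zeta> * (x \<zeta> * cnj (x \<xi>)))"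
    using assms unfolding has_block_expansion_def by (intro sums_sum sums_mult2) blast
  moreover have "(\<Sum>\<xi>\<in>\<Xi>. \<Sum>\<zeta>\<in>\<Xi>. ?t \<xi> \<zeta> j * (x \<zeta> * cnj (x \<xi>)))
      = block_form d j (\<lambda>k. \<Sum>\<xi>\<in>\<Xi>. cnj (x \<xi>) * sph_harm j k \<xi>)" for j
  proof -
    let ?I = "{- int j..int j}"
    let ?s = "\<lambda>\<xi> \<zeta> k k'. d j k k' * (cnj (x \<xi>) * sph_harm j k \<xi>) * cnj (cnj (x \<zeta>) * sph_harm j k' \<zeta>)"
    have swap: "(\<Sum>\<xi>\<in>\<Xi>. \<Sum>\<zeta>\<in>\<Xi>. \<Sum>k\<in>?I. f \<xi> \<zeta> k) = (\<Sum>k\<in>?I. \<Sum>\<xi>\<in>\<Xi>. \<Sum>\<zeta>\<in>\<Xi>. f \<xi> \<zeta> k)"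
      for f :: "_ \<Rightarrow> _ \<Rightarrow> _ \<Rightarrow> complex"
    proof -
      have "(\<Sum>\<xi>\<in>\<Xi>. \<Sum>\<zeta>\<in>\<Xi>. \<Sum>k\<in>?I. f \<xi> \<zeta> k) = (\<Sum>\<xi>\<in>\<Xi>. \<Sum>k\<in>?I. \<Sum>\<zeta>\<in>\<Xi>. f \<xi> \<zeta> k)"
        by (intro sum.cong refl sum.swap)
      also have "\<dots> = (\<Sum>k\<in>?I. \<Sum>\<xi>\<in>\<Xi>. \<Sum>\<zeta>\<in>\<Xi>. f \<xi> \<zeta> k)"
        by (rule sum.swap)
      finally show ?thesis .
    qed
    have "(\<Sum>\<xi>\<in>\<Xi>. \<Sum>\<zeta>\<in>\<Xi>. ?t \<xi> \<zeta> j * (x \<zeta> * cnj (x \<xi>)))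
        = (\<Sum>\<xi>\<in>\<Xi>. \<Sum>\<zeta>\<in>\<Xi>. \<Sum>k\<in>?I. \<Sum>k'\<in>?I. ?s \<xi> \<zeta> k k')"
      unfolding sum_distrib_right by (intro sum.cong refl) (simp add: mult_ac)
    also have "\<dots> = (\<Sum>k\<in>?I. \<Sum>\<xi>\<in>\<Xi>. \<Sum>\<zeta>\<in>\<Xi>. \<Sum>k'\<in>?I. ?s \<xi> \<zeta> k k')"
      by (rule swap)
    also have "\<dots> = (\<Sum>k\<in>?I. \<Sum>k'\<in>?I. \<Sum>\<xi>\<in>\<Xi>. \<Sum>\<zeta>\<in>\<Xi>. ?s \<xi> \<zeta> k k')"
      by (intro sum.cong refl swap)
    also have "\<dots> = block_form d j (\<lambda>k. \<Sum>\<xi>\<in>\<Xi>. cnj (x \<xi>) * sph_harm j k \<xi>)"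
      unfolding block_form_def
      by (intro sum.cong refl)
        (simp only: cnj_sum sum_product mult.assoc[of "d j k k'" for k k'], simp only: sum_distrib_left)
    finally show ?thesis .
  qed
  moreover have "(\<Sum>\<xi>\<in>\<Xi>. \<Sum>\<zeta>\<in>\<Xi>. K \<xi> \<zeta> * (x \<zeta> * cnj (x \<xi>)))
      = coord_inner \<Xi> (kernel_operator K \<Xi> x) x"
    by (simp add: coord_inner_def kernel_operator_def sum_distrib_right mult.assoc)
  ultimately show ?thesis
    by simp
qed

text \<open>All blocks contribute nonnegatively, so if the quadratic form vanishes at \<open>x\<close>, then every single
  block does. In the strictly positive degrees this makes the combination of point evaluations with
  coefficients \<open>cnj (x \<xi>)\<close> annihilate all harmonics of that degree and nonnegative order, which
  already forces \<open>x = 0\<close>.\<close>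

theorem theorem4:
  fixes K :: "real^3 \<Rightarrow> real^3 \<Rightarrow> complex"
    and d :: "nat \<Rightarrow> int \<Rightarrow> int \<Rightarrow> complex"
  assumes "continuous_on (S2 \<times> S2) (\<lambda>(\<xi>, \<zeta>). K \<xi> \<zeta>)"
    and "hermitian_kernel K"
    and "positive_definite_kernel K"
    and "has_block_expansion K d"
    and "infinite {j \<in> strictly_positive_degrees d. even j}"
    and "infinite {j \<in> strictly_positive_degrees d. odd j}"
  shows "strictly_positive_definite_kernel K"
  unfolding strictly_positive_definite_kernel_def
proof (intro conjI allI impI)
  show "hermitian_kernel K" by fact
next
  interpret continuous_sphere_kernel K
    using assms(1) by unfold_locales
  fix \<Xi> :: "(real^3) set"
  assume \<Xi>: "finite \<Xi> \<and> \<Xi> \<subseteq> S2"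
  then have pos: "positive_operator_on \<Xi> (kernel_operator K \<Xi>)"
    using assms(3) by (simp add: positive_definite_kernel_def)
  have "0 < coord_inner \<Xi> (kernel_operator K \<Xi> x) x"
    if x: "x \<in> coord_space \<Xi> - {\<lambda>\<xi>\<in>\<Xi>. 0}" for x
  proof (rule ccontr)
    assume not_pos: "\<not> 0 < coord_inner \<Xi> (kernel_operator K \<Xi> x) x"
    have "0 \<le> coord_inner \<Xi> (kernel_operator K \<Xi> x) x"
      using pos x by (simp add: positive_operator_on_def)
    with not_pos have zero: "coord_inner \<Xi> (kernel_operator K \<Xi> x) x = 0"
      by (simp add: order_less_le)
    define a where "a j k = (\<Sum>\<xi>\<in>\<Xi>. cnj (x \<xi>) * sph_harm j k \<xi>)" for j k
    have "(\<lambda>j. block_form d j (a j)) sums 0"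
      using kernel_quadratic_form_sums[OF assms(4), of \<Xi> x] \<Xi> by (simp add: zero a_def[abs_def])
    then have "(\<lambda>j. Re (block_form d j (a j))) sums 0"
      using sums_Re by force
    then have form_zero: "Re (block_form d j (a j)) = 0" for j
      using suminf_eq_zero_iff[of "\<lambda>j. Re (block_form d j (a j))"] block_form_nonneg[OF assms(3,4)]
      by (simp add: sums_iff)
    have "(\<Sum>\<xi>\<in>\<Xi>. cnj (x \<xi>) * unnormalized_harm j l \<xi>) = 0"
      if j: "j \<in> strictly_positive_degrees d" and "l \<le> j" for j l
    proof -
      obtain c where c: "c \<noteq> 0" "\<forall>\<xi>\<in>S2. sph_harm j (int (j - l)) \<xi> = c * unnormalized_harm j l \<xi>"
        using sph_harm_nonneg_order[of "j - l" j] \<open>l \<le> j\<close> by auto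
      have "int (j - l) \<in> {- int j..int j}"
        by simp
      then have "a j (int (j - l)) = 0"
        using block_form_pos[OF j, of "int (j - l)" "a j"] form_zero by auto
      moreover have "a j (int (j - l)) = c * (\<Sum>\<xi>\<in>\<Xi>. cnj (x \<xi>) * unnormalized_harm j l \<xi>)"
        unfolding a_def sum_distrib_left using c(2) \<Xi> by (intro sum.cong) auto
      ultimately show ?thesis
        using c(1) by simp
    qed
    with harmonic_annihilator_trivial[of \<Xi> "strictly_positive_degrees d" "\<lambda>\<xi>. cnj (x \<xi>)"] \<Xi> assms(5,6)
    have "\<forall>\<xi>\<in>\<Xi>. x \<xi> = 0"
      by simp
    with x have "x = (\<lambda>\<xi>\<in>\<Xi>. 0)"
      by (intro extensionalityI[of _ \<Xi>]) (auto simp: PiE_def)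
    with x show False
      by simp
  qed
  with pos show "strictly_positive_operator_on \<Xi> (kernel_operator K \<Xi>)"
    by (simp add: strictly_positive_operator_on_def positive_operator_on_def)
qed

end
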